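(* For every fixed integer $r\ge 2$, as $n\to\infty$, \[ \kappa_{r,2}(K_n)\sim \left(1-\frac1r\right)n, \] and for every fixed integer $\ell\ge 3$, \[ \kappa_{r,\ell}(K_n)\sim \frac{n}{\ell-1}. \]
   Context: $K_n$ is the complete graph on $n$ vertices. An $r$-edge-coloring is a map from the edge set to $[r]$ (not all colors need be used). A path is alternating if any two adjacent edges of it have different colors; the length of a path is its number of edges; paths between two vertices are internally disjoint if they share no vertices other than their endpoints. The alternating connectivity $\kappa_{r,\ell}(G)$ of a graph $G$ is the maximum $t$ such that there is an $r$-edge-coloring of $G$ in which every pair of distinct vertices is connected by $t$ internally disjoint alternating paths of length $\ell$. $f\sim g$ means $f/g\to1$. *)

theory Defs
  imports Complex_Main "HOL-Library.FuncSet" "HOL-Library.Landau_Symbols"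
begin

text \<open>A graph is a pair of a vertex set and a set of edges, an edge being the two-element
  set of its endpoints.\<close>

type_synonym 'a graph = "'a set \<times> 'a set set"

definition complete_graph :: "nat \<Rightarrow> nat graph" where
  "complete_graph n = ({1..n}, {e. e \<subseteq> {1..n} \<and> card e = 2})"

definition edge_coloring :: "nat \<Rightarrow> 'a graph \<Rightarrow> ('a set \<Rightarrow> nat) \<Rightarrow> bool" where
  "edge_coloring r G c \<longleftrightarrow> c \<in> snd G \<rightarrow> {1..r}"

text \<open>A path is the list of its vertices, so one of length \<open>l\<close> has \<open>l + 1\<close> entries.\<close>

definition path_between :: "'a graph \<Rightarrow> nat \<Rightarrow> 'a \<Rightarrow> 'a \<Rightarrow> 'a list \<Rightarrow> bool" where
  "path_between G l u v p \<longleftrightarrow>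
     length p = l + 1 \<and> hd p = u \<and> last p = v \<and> distinct p \<and> set p \<subseteq> fst G \<and>
     (\<forall>i<l. {p ! i, p ! (i + 1)} \<in> snd G)"

definition alternating :: "('a set \<Rightarrow> nat) \<Rightarrow> 'a list \<Rightarrow> bool" where
  "alternating c p \<longleftrightarrow>
     (\<forall>i. i + 2 < length p \<longrightarrow> c {p ! i, p ! (i + 1)} \<noteq> c {p ! (i + 1), p ! (i + 2)})"

definition internally_disjoint :: "'a \<Rightarrow> 'a \<Rightarrow> 'a list set \<Rightarrow> bool" where
  "internally_disjoint u v P \<longleftrightarrow> (\<forall>p\<in>P. \<forall>q\<in>P. p \<noteq> q \<longrightarrow> set p \<inter> set q \<subseteq> {u, v})"

definition alternating_connected :: "nat \<Rightarrow> 'a graph \<Rightarrow> ('a set \<Rightarrow> nat) \<Rightarrow> nat \<Rightarrow> bool" where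
  "alternating_connected l G c t \<longleftrightarrow>
     (\<forall>u\<in>fst G. \<forall>v\<in>fst G. u \<noteq> v \<longrightarrow>
        (\<exists>P. finite P \<and> card P = t \<and> internally_disjoint u v P \<and>
             (\<forall>p\<in>P. path_between G l u v p \<and> alternating c p)))"

text \<open>The maximum exists as soon as \<open>G\<close> is finite with at least two vertices and \<open>r \<ge> 1\<close>
  (shown below); for complete graphs it is left unspecified only for \<open>n \<le> 1\<close>, where every
  \<open>t\<close> qualifies vacuously.\<close>

definition alternating_connectivity :: "nat \<Rightarrow> nat \<Rightarrow> 'a graph \<Rightarrow> nat" where
  "alternating_connectivity r l G =
     Max {t. \<exists>c. edge_coloring r G c \<and> alternating_connected l G c t}"

lemma alternating_connectivity_max_exists:
  assumes "finite (fst G)" "u \<in> fst G" "v \<in> fst G" "u \<noteq> v" "r \<ge> 1"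
  shows "finite {t. \<exists>c. edge_coloring r G c \<and> alternating_connected l G c t}" (is "finite ?T")
    and "{t. \<exists>c. edge_coloring r G c \<and> alternating_connected l G c t} \<noteq> {}"
proof -
  let ?L = "{p. set p \<subseteq> fst G \<and> length p = l + 1}"
  have fin: "finite ?L"
    by (rule finite_lists_length_eq[OF assms(1)])
  have "t \<le> card ?L" if "t \<in> ?T" for t
  proof -
    from that obtain c where "alternating_connected l G c t" by blast
    then obtain P where "card P = t" "\<forall>p\<in>P. path_between G l u v p"
      using assms(2-4) unfolding alternating_connected_def by blast
    moreover from this have "P \<subseteq> ?L" by (auto simp: path_between_def)
    ultimately show ?thesis using card_mono[OF fin] by blast
  qed
  then show "finite ?T"
    by (meson finite_nat_set_iff_bounded_le)
  have "edge_coloring r G (\<lambda>_. 1)" "alternating_connected l G (\<lambda>_. 1) 0"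
    using assms(5) by (auto simp: edge_coloring_def alternating_connected_def
        internally_disjoint_def intro!: exI[of _ "{}"])
  then show "?T \<noteq> {}" by blast
qed

end

theory Submission
  imports Defs "HOL-Probability.Hoeffding" "HOL-Real_Asymp.Real_Asymp"
begin

text \<open>
  The upper bounds are counting: for length 2, average over all pairs \<open>u, v\<close> the number of
  middle vertices seeing \<open>u\<close> and \<open>v\<close> in different colors; for length \<open>l\<close>, the paths use
  disjoint sets of \<open>l - 1\<close> inner vertices.

  For the lower bounds take a random coloring. By Hoeffding's inequality every pair \<open>u, v\<close>
  sees each pair of colors on about \<open>n / r\<^sup>2\<close> vertices, which settles length 2. For longer
  paths two colors suffice. The rows of the corresponding sign matrix are almost orthogonal, so any
  two disjoint sets of linear size span edges of both colors, and alternating paths through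
  prescribed disjoint sets of inner vertices can be chosen greedily until only \<open>o(n)\<close> vertices of
  each set are left. It remains to split the vertices into such sets: the first one must be
  joined to \<open>u\<close>, and the last one to \<open>v\<close>, in prescribed colors. For \<open>l = 3\<close> one
  such family cannot exhaust all vertices, and one uses two, with opposite starting colors.
\<close>

section \<open>Quasirandom colorings\<close>

text \<open>Think of \<open>a w\<close> and \<open>b w\<close> as the edges from \<open>w\<close> to
  two fixed vertices. The pairs \<open>{a w, b w}\<close> are disjoint for different
  \<open>w\<close>, so the indicators of the joint color event are independent with mean
  \<open>1 / r^2\<close>, and the lower tail of Hoeffding's inequality applies.\<close>

lemma prob_joint_count_le:
  fixes a b :: "'w \<Rightarrow> 'e" and d r i j :: nat and \<delta> :: real
  assumes E: "finite E" and W: "finite W" "W \<noteq> {}"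
    and a: "a ` W \<subseteq> E" "inj_on a W" and b: "b ` W \<subseteq> E" "inj_on b W"
    and ab: "a ` W \<inter> b ` W = {}"
    and ij: "i \<in> {1..r}" "j \<in> {1..r}" and \<delta>: "\<delta> \<ge> 0"
  shows "measure_pmf.prob (Pi_pmf E d (\<lambda>_. pmf_of_set {1..r}))
           {c. real (card {w\<in>W. c (a w) = i \<and> c (b w) = j})
                 \<le> (1 / real r ^ 2 - \<delta>) * real (card W)}
         \<le> exp (- 2 * \<delta>\<^sup>2 * real (card W))"
proof -
  define M where "M = Pi_pmf E d (\<lambda>_. pmf_of_set {1..r})"
  define X :: "'w \<Rightarrow> ('e \<Rightarrow> nat) \<Rightarrow> real"
    where "X = (\<lambda>w c. if c (a w) = i \<and> c (b w) = j then 1 else 0)"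
  have r: "r \<ge> 1" using ij by auto
  have ab_neq: "a w \<noteq> b w" if "w \<in> W" for w
    using ab that by auto
  have indep0: "prob_space.indep_vars M (\<lambda>_. count_space UNIV) (\<lambda>e c. c e) E"
    unfolding M_def by (rule indep_vars_Pi_pmf[OF E])
  have disj: "disjoint_family_on (\<lambda>w. {a w, b w}) W"
    unfolding disjoint_family_on_def
  proof (intro ballI impI)
    fix w w' assume w: "w \<in> W" "w' \<in> W" "w \<noteq> w'"
    have "a w \<noteq> a w'" "b w \<noteq> b w'"
      using w a(2) b(2) by (auto dest: inj_onD)
    moreover have "a w \<noteq> b w'" "b w \<noteq> a w'"
      using w ab by (metis IntI empty_iff imageI)+
    ultimately show "{a w, b w} \<inter> {a w', b w'} = {}" by simp
  qed
  have indep1: "prob_space.indep_vars M (\<lambda>w. PiM {a w, b w} (\<lambda>_. count_space UNIV))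
      (\<lambda>w c. restrict (\<lambda>e. c e) {a w, b w}) W"
    using a b by (intro prob_space.indep_vars_restrict[OF measure_pmf.prob_space_axioms indep0 _ disj]) auto
  have indep2: "prob_space.indep_vars M (\<lambda>_. borel)
      (\<lambda>w c. (\<lambda>f. if f (a w) = i \<and> f (b w) = j then 1 else (0::real))
         (restrict (\<lambda>e. c e) {a w, b w})) W"
  proof (rule prob_space.indep_vars_compose2[OF measure_pmf.prob_space_axioms indep1])
    fix w assume "w \<in> W"
    have [measurable]: "(\<lambda>f. f (a w)) \<in> PiM {a w, b w} (\<lambda>_. count_space UNIV) \<rightarrow>\<^sub>M count_space (UNIV::nat set)"
      "(\<lambda>f. f (b w)) \<in> PiM {a w, b w} (\<lambda>_. count_space UNIV) \<rightarrow>\<^sub>M count_space (UNIV::nat set)"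
      by (auto intro!: measurable_component_singleton)
    show "(\<lambda>f. if f (a w) = i \<and> f (b w) = j then 1 else (0::real))
        \<in> PiM {a w, b w} (\<lambda>_. count_space UNIV) \<rightarrow>\<^sub>M borel"
      by measurable
  qed
  have indep: "prob_space.indep_vars M (\<lambda>_. borel) X W"
    using indep2 by (simp add: X_def)
  have expect: "measure_pmf.expectation M (X w) = 1 / real r ^ 2" if w: "w \<in> W" for w
  proof -
    \<comment> \<open>The event is a box: two coordinates are prescribed and the others are free, so
      the product measure leaves just two factors \<open>1 / r\<close>.\<close>
    define B where "B = (\<lambda>e. if e = a w then {i} else if e = b w then {j} else UNIV)"
    have sub: "{a w, b w} \<subseteq> E" using a b w by auto
    have "measure_pmf.expectation M (X w) = measure_pmf.prob M (Pi E B)"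
    proof -
      have "X w = indicator (Pi E B)"
        using sub ab_neq[OF w] by (auto simp: X_def B_def fun_eq_iff indicator_def Pi_def)
      then show ?thesis by simp
    qed
    also have "\<dots> = (\<Prod>e\<in>E. measure_pmf.prob (pmf_of_set {1..r}) (B e))"
      unfolding M_def by (rule measure_Pi_pmf_Pi[OF E])
    also have "\<dots> = (\<Prod>e\<in>{a w, b w}. measure_pmf.prob (pmf_of_set {1..r}) (B e))"
      using sub by (intro prod.mono_neutral_right[OF E]) (auto simp: B_def)
    also have "\<dots> = 1 / real r ^ 2"
      using ab_neq[OF w] ij r by (simp add: B_def measure_pmf_single power2_eq_square)
    finally show ?thesis .
  qed
  interpret H: Hoeffding_ineq M W X "\<lambda>_. 0" "\<lambda>_. 1" "\<Sum>w\<in>W. measure_pmf.expectation M (X w)"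
  proof unfold_locales
    show "prob_space.indep_vars M (\<lambda>_. borel) X W" by (rule indep)
  qed (auto simp: W X_def)
  have cW: "card W > 0" using W by (simp add: card_gt_0_iff)
  have count: "(\<Sum>w\<in>W. X w c) = real (card {w\<in>W. c (a w) = i \<and> c (b w) = j})" for c
    using W by (simp add: X_def sum.If_cases Int_def)
  have "measure_pmf.prob M {c\<in>space (measure_pmf M).
      (\<Sum>w\<in>W. X w c) \<le> (\<Sum>w\<in>W. measure_pmf.expectation M (X w)) - \<delta> * card W}
    \<le> exp (-2 * (\<delta> * card W)\<^sup>2 / (\<Sum>w\<in>W. (1 - 0)\<^sup>2))"
    by (rule H.Hoeffding_ineq_le) (use \<delta> cW in auto)
  also have "(\<Sum>w\<in>W. measure_pmf.expectation M (X w)) - \<delta> * card W = (1 / real r ^ 2 - \<delta>) * card W"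
    by (simp add: expect algebra_simps)
  also have "-2 * (\<delta> * card W)\<^sup>2 / (\<Sum>w\<in>W. (1 - 0)\<^sup>2) = - 2 * \<delta>\<^sup>2 * real (card W)"
    using cW by (simp add: power2_eq_square field_simps)
  finally show ?thesis
    by (simp add: count M_def)
qed

definition joint_type :: "nat \<Rightarrow> (nat set \<Rightarrow> nat) \<Rightarrow> nat \<Rightarrow> nat \<Rightarrow> nat \<Rightarrow> nat \<Rightarrow> nat set" where
  "joint_type n c u v i j = {w\<in>{1..n} - {u, v}. c {u, w} = i \<and> c {v, w} = j}"

text \<open>One-sided bounds carry the full information: the \<open>r^2\<close> types partition the
  \<open>n - 2\<close> vertices other than \<open>u\<close> and \<open>v\<close>, so bounding all of
  them from below also bounds each from above.\<close>

definition quasirandom_coloring :: "nat \<Rightarrow> real \<Rightarrow> nat \<Rightarrow> (nat set \<Rightarrow> nat) \<Rightarrow> bool" where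
  "quasirandom_coloring r \<delta> n c \<longleftrightarrow>
     edge_coloring r (complete_graph n) c \<and>
     (\<forall>u\<in>{1..n}. \<forall>v\<in>{1..n}. u \<noteq> v \<longrightarrow> (\<forall>i\<in>{1..r}. \<forall>j\<in>{1..r}.
        (1 / real r ^ 2 - \<delta>) * (real n - 2) \<le> real (card (joint_type n c u v i j))))"

text \<open>Union bound: there are at most \<open>n^2 * r^2\<close> choices of two vertices and two
  colors, and each fails with probability exponentially small in \<open>n\<close>.\<close>

lemma ex_quasirandom_coloring:
  fixes \<delta> :: real
  assumes r: "r \<ge> 1" and \<delta>: "\<delta> > 0"
  shows "eventually (\<lambda>n. \<exists>c. quasirandom_coloring r \<delta> n c) sequentially"
proof -
  have "eventually (\<lambda>n::nat. real n ^ 2 * real r ^ 2 * exp (- 2 * \<delta>\<^sup>2 * (real n - 2)) < 1) sequentially"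
  proof (rule order_tendstoD(2))
    show "(\<lambda>n::nat. real n ^ 2 * real r ^ 2 * exp (- 2 * \<delta>\<^sup>2 * (real n - 2))) \<longlonglongrightarrow> 0"
      using r \<delta> by real_asymp
  qed simp
  then show ?thesis
    using eventually_gt_at_top[of 2]
  proof eventually_elim
    case (elim n)
    define E where "E = snd (complete_graph n)"
    define M where "M = Pi_pmf E 0 (\<lambda>_. pmf_of_set {1..r})"
    define I where "I = {(u, v). u \<in> {1..n} \<and> v \<in> {1..n} \<and> u \<noteq> v} \<times> ({1..r} \<times> {1..r})"
    define bad where "bad = (\<lambda>((u, v), (i, j)).
      {c. real (card (joint_type n c u v i j)) \<le> (1 / real r ^ 2 - \<delta>) * (real n - 2)})"
    have E: "finite E" "{x, y} \<in> E \<longleftrightarrow> x \<noteq> y \<and> x \<in> {1..n} \<and> y \<in> {1..n}" for x y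
    proof -
      show "finite E"
        by (rule finite_subset[of _ "Pow {1..n}"]) (auto simp: E_def complete_graph_def)
      show "{x, y} \<in> E \<longleftrightarrow> x \<noteq> y \<and> x \<in> {1..n} \<and> y \<in> {1..n}" for x y
        by (cases "x = y") (auto simp: E_def complete_graph_def)
    qed
    have bad: "measure_pmf.prob M (bad x) \<le> exp (- 2 * \<delta>\<^sup>2 * (real n - 2))" if "x \<in> I" for x
    proof -
      obtain u v i j where x: "x = ((u, v), (i, j))" by (metis prod.exhaust)
      have uv: "u \<in> {1..n}" "v \<in> {1..n}" "u \<noteq> v" "i \<in> {1..r}" "j \<in> {1..r}"
        using that by (auto simp: x I_def)
      define W where "W = {1..n} - {u, v}"
      have cW: "card W = n - 2" using uv by (simp add: W_def card_Diff_subset)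
      have W: "finite W" "W \<noteq> {}"
        using cW elim(2) by (simp add: W_def, metis card.empty not_less0 zero_less_diff)
      have "measure_pmf.prob M {c. real (card {w\<in>W. c {u, w} = i \<and> c {v, w} = j})
                 \<le> (1 / real r ^ 2 - \<delta>) * real (card W)} \<le> exp (- 2 * \<delta>\<^sup>2 * real (card W))"
        unfolding M_def using W uv \<delta> E
        by (intro prob_joint_count_le) (auto simp: W_def inj_on_def doubleton_eq_iff)
      moreover have "joint_type n c u v i j = {w\<in>W. c {u, w} = i \<and> c {v, w} = j}" for c
        by (simp only: joint_type_def W_def)
      ultimately show ?thesis
        using elim by (simp add: x bad_def cW of_nat_diff)
    qed
    have finI: "finite I"
      by (rule finite_subset[of _ "({1..n} \<times> {1..n}) \<times> ({1..r} \<times> {1..r})"]) (auto simp: I_def)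
    have "card I \<le> card (({1..n} \<times> {1..n}) \<times> ({1..r} \<times> {1..r}))"
      by (intro card_mono) (auto simp: I_def)
    then have cI: "real (card I) \<le> real n ^ 2 * real r ^ 2"
      by (simp add: card_cartesian_product power2_eq_square mult.assoc flip: of_nat_mult)
    have "measure_pmf.prob M (\<Union>x\<in>I. bad x) \<le> (\<Sum>x\<in>I. measure_pmf.prob M (bad x))"
      by (rule measure_pmf.finite_measure_subadditive_finite) (use finI in auto)
    also have "\<dots> \<le> (\<Sum>x\<in>I. exp (- 2 * \<delta>\<^sup>2 * (real n - 2)))"
      by (intro sum_mono bad)
    also have "\<dots> \<le> real n ^ 2 * real r ^ 2 * exp (- 2 * \<delta>\<^sup>2 * (real n - 2))"
      using cI by (simp add: mult_right_mono)
    also have "\<dots> < 1" by (rule elim)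
    finally have less: "measure_pmf.prob M (\<Union>x\<in>I. bad x) < 1" .
    \<comment> \<open>The good coloring is sought in the support of \<open>M\<close>, since
      membership there forces colors in \<open>{1..r}\<close> on every edge.\<close>
    have "\<exists>c\<in>set_pmf M. c \<notin> (\<Union>x\<in>I. bad x)"
    proof (rule ccontr)
      assume "\<not> ?thesis"
      then have "set_pmf M \<subseteq> (\<Union>x\<in>I. bad x)" by blast
      then have "measure_pmf.prob M (\<Union>x\<in>I. bad x) = 1"
        by (subst measure_pmf.prob_eq_1) (auto simp: AE_measure_pmf_iff)
      then show False using less by simp
    qed
    then obtain c where c: "c \<in> set_pmf M" "\<And>x. x \<in> I \<Longrightarrow> c \<notin> bad x" by blast
    have "c \<in> E \<rightarrow> {1..r}"
      using c(1) r unfolding M_def by (subst (asm) set_Pi_pmf) (auto simp: E PiE_dflt_def)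
    moreover have "(1 / real r ^ 2 - \<delta>) * (real n - 2) \<le> real (card (joint_type n c u v i j))"
      if "u \<in> {1..n}" "v \<in> {1..n}" "u \<noteq> v" "i \<in> {1..r}" "j \<in> {1..r}" for u v i j
      using c(2)[of "((u, v), (i, j))"] that by (auto simp: I_def bad_def)
    ultimately show ?case
      by (auto simp: quasirandom_coloring_def edge_coloring_def E_def)
  qed
qed

section \<open>Disjoint alternating paths through prescribed sets\<close>

text \<open>With \<open>M\<close> the sign matrix of the coloring, compare
  \<open>\<Sum>w. (\<Sum>a\<in>A. M a w)\<^sup>2\<close> with its restriction to \<open>w \<in> B\<close>, where all signs agree.\<close>

lemma no_edge_between_card_bound:
  fixes \<delta> :: real
  assumes qr: "quasirandom_coloring 2 \<delta> n c" and \<delta>: "\<delta> \<ge> 0"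
    and A: "A \<subseteq> {1..n}" and B: "B \<subseteq> {1..n}" and AB: "A \<inter> B = {}"
    and k: "k \<in> {1, 2}" and no: "\<And>a b. a \<in> A \<Longrightarrow> b \<in> B \<Longrightarrow> c {a, b} \<noteq> k"
  shows "real (card A) * real (card B) \<le> real n + 4 * \<delta> * real n * real (card A)"
proof -
  define V where "V = {1..n}"
  define M :: "nat \<Rightarrow> nat \<Rightarrow> real"
    where "M = (\<lambda>a w. if w = a then 0 else if c {a, w} = 1 then 1 else -1)"
  have V: "finite V" "card V = n" "A \<subseteq> V" "B \<subseteq> V" using A B by (auto simp: V_def)
  then have fin: "finite A" "finite B" by (auto intro: finite_subset)
  have col: "c {x, y} \<in> {1, 2}" if "x \<in> V" "y \<in> V" "x \<noteq> y" for x y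
  proof -
    have "{x, y} \<in> snd (complete_graph n)"
      using that by (auto simp: complete_graph_def V_def)
    then have "c {x, y} \<in> {1..2}"
      using qr unfolding quasirandom_coloring_def edge_coloring_def by blast
    then show ?thesis by auto
  qed
  have inner_le: "(\<Sum>w\<in>V. M a w * M a' w) \<le> (if a = a' then real n else 4 * \<delta> * real n)"
    if a: "a \<in> A" "a' \<in> A" for a a'
  proof (cases "a = a'")
    case True
    have "(\<Sum>w\<in>V. M a w * M a' w) \<le> (\<Sum>w\<in>V. 1)"
      by (intro sum_mono) (auto simp: M_def True)
    then show ?thesis using V True by simp
  next
    case False
    define W where "W = V - {a, a'}"
    have aV: "a \<in> V" "a' \<in> V" using a V by auto
    then have cW: "real (card W) = real n - 2"
    proof -
      have "card {a, a'} \<le> card V" using aV V by (intro card_mono) auto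
      then show ?thesis using aV V False by (simp add: W_def card_Diff_subset of_nat_diff)
    qed
    have finW: "finite W" using V by (simp add: W_def)
    have T: "(1 / 4 - \<delta>) * (real n - 2) \<le> real (card (W \<inter> {w. c {a, w} = i \<and> c {a', w} = j}))"
      if "i \<in> {1..2}" "j \<in> {1..2}" for i j
    proof -
      have "joint_type n c a a' i j = W \<inter> {w. c {a, w} = i \<and> c {a', w} = j}"
        by (auto simp: joint_type_def W_def V_def)
      then show ?thesis
        using qr aV False that unfolding quasirandom_coloring_def V_def by fastforce
    qed
    have "(\<Sum>w\<in>V. M a w * M a' w) = (\<Sum>w\<in>W. M a w * M a' w)"
      using V by (intro sum.mono_neutral_right) (auto simp: W_def M_def)
    \<comment> \<open>A product of two signs is 1, lowered by 2 when the colors differ. Lower bounds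
      on the two mixed types therefore bound the inner product from above.\<close>
    also have "\<dots> = (\<Sum>w\<in>W. 1 - 2 * of_bool (c {a, w} = 1 \<and> c {a', w} = 2)
                          - 2 * of_bool (c {a, w} = 2 \<and> c {a', w} = 1))"
    proof (intro sum.cong refl)
      fix w assume "w \<in> W"
      then have "c {a, w} \<in> {1, 2}" "c {a', w} \<in> {1, 2}" "w \<noteq> a" "w \<noteq> a'"
        using col aV by (auto simp: W_def)
      then show "M a w * M a' w = 1 - 2 * of_bool (c {a, w} = 1 \<and> c {a', w} = 2)
                          - 2 * of_bool (c {a, w} = 2 \<and> c {a', w} = 1)"
        by (auto simp: M_def)
    qed
    also have "\<dots> = real (card W) - 2 * real (card (W \<inter> {w. c {a, w} = 1 \<and> c {a', w} = 2}))
         - 2 * real (card (W \<inter> {w. c {a, w} = 2 \<and> c {a', w} = 1}))"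
      using finW by (simp only: sum_subtractf sum_distrib_left[symmetric] sum_of_bool_eq sum_constant mult_1_right)
    also have "\<dots> \<le> (real n - 2) - 2 * ((1 / 4 - \<delta>) * (real n - 2)) - 2 * ((1 / 4 - \<delta>) * (real n - 2))"
    proof -
      have "(1 / 4 - \<delta>) * (real n - 2) \<le> real (card (W \<inter> {w. c {a, w} = 1 \<and> c {a', w} = 2}))"
        "(1 / 4 - \<delta>) * (real n - 2) \<le> real (card (W \<inter> {w. c {a, w} = 2 \<and> c {a', w} = 1}))"
        by (rule T; simp)+
      then show ?thesis unfolding cW by linarith
    qed
    also have "\<dots> = 4 * \<delta> * (real n - 2)" by (simp add: algebra_simps)
    also have "\<dots> \<le> 4 * \<delta> * real n" using \<delta> by (intro mult_left_mono) auto
    finally show ?thesis using False by simp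
  qed
  \<comment> \<open>Every \<open>b\<close> in \<open>B\<close> is joined to all of \<open>A\<close>
    in the color other than \<open>k\<close>, so its column sum over \<open>A\<close> is plus or
    minus \<open>card A\<close>.\<close>
  have "real (card B) * real (card A) ^ 2 = (\<Sum>b\<in>B. (\<Sum>a\<in>A. M a b) ^ 2)"
  proof -
    have "(\<Sum>a\<in>A. M a b) ^ 2 = real (card A) ^ 2" if "b \<in> B" for b
    proof -
      have "M a b = (if k = 1 then -1 else 1)" if a: "a \<in> A" for a
      proof -
        have "c {a, b} \<in> {1, 2}" "a \<noteq> b" using col a \<open>b \<in> B\<close> V AB by blast+
        then show ?thesis using no[OF a \<open>b \<in> B\<close>] k by (auto simp: M_def)
      qed
      then show ?thesis by simp
    qed
    then show ?thesis by simp
  qed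
  also have "\<dots> \<le> (\<Sum>w\<in>V. (\<Sum>a\<in>A. M a w) ^ 2)"
    using V by (intro sum_mono2) auto
  also have "\<dots> = (\<Sum>w\<in>V. \<Sum>a\<in>A. \<Sum>a'\<in>A. M a w * M a' w)"
    by (simp add: power2_eq_square sum_product)
  also have "\<dots> = (\<Sum>a\<in>A. \<Sum>w\<in>V. \<Sum>a'\<in>A. M a w * M a' w)"
    by (rule sum.swap)
  also have "\<dots> = (\<Sum>a\<in>A. \<Sum>a'\<in>A. \<Sum>w\<in>V. M a w * M a' w)"
    by (rule sum.cong[OF refl], rule sum.swap)
  \<comment> \<open>The off-diagonal bound is charged to the diagonal terms as well. One factor
    \<open>card A\<close> then cancels at the end.\<close>
  also have "\<dots> \<le> (\<Sum>a\<in>A. \<Sum>a'\<in>A. (if a = a' then real n else 0) + 4 * \<delta> * real n)"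
  proof (intro sum_mono)
    fix a a' assume "a \<in> A" "a' \<in> A"
    moreover have "0 \<le> 4 * \<delta> * real n" using \<delta> by simp
    ultimately show "(\<Sum>w\<in>V. M a w * M a' w) \<le> (if a = a' then real n else 0) + 4 * \<delta> * real n"
      using inner_le[of a a'] by (cases "a = a'") simp_all
  qed
  also have "\<dots> = real (card A) * (real n + 4 * \<delta> * real n * real (card A))"
    using fin by (simp add: sum.distrib algebra_simps)
  finally have "real (card A) * (real (card A) * real (card B))
      \<le> real (card A) * (real n + 4 * \<delta> * real n * real (card A))"
    by (simp add: power2_eq_square algebra_simps)
  then show ?thesis
    by (cases "card A = 0") auto
qed

text \<open>This is all that the edges between consecutive inner vertices require of the coloring;
  the first and last edges are handled through joint types.\<close>

definition both_colors_between_sets :: "nat \<Rightarrow> nat \<Rightarrow> (nat set \<Rightarrow> nat) \<Rightarrow> bool" where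
  "both_colors_between_sets s n c \<longleftrightarrow>
     (\<forall>X Y k. X \<subseteq> {1..n} \<longrightarrow> Y \<subseteq> {1..n} \<longrightarrow> X \<inter> Y = {} \<longrightarrow> s \<le> card X \<longrightarrow> s \<le> card Y \<longrightarrow>
        k \<in> {1, 2} \<longrightarrow> (\<exists>x\<in>X. \<exists>y\<in>Y. c {x, y} = k))"

text \<open>Induction on \<open>m\<close>, counting endpoints rather than merely finding one. If at
  least \<open>s\<close> vertices of \<open>A m\<close> are reachable, the unreachable vertices of
  \<open>A (Suc m)\<close> send them no edge of color \<open>\<kappa> m\<close>, so they number
  fewer than \<open>s\<close>, and more than \<open>s\<close> of the at least \<open>2 * s\<close>
  vertices are reachable.\<close>

lemma card_reachable_by_transversal:
  assumes bc: "both_colors_between_sets s n c"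
    and A: "\<And>i. i \<le> m \<Longrightarrow> A i \<subseteq> {1..n}" "\<And>i. i \<le> m \<Longrightarrow> 2 * s \<le> card (A i)"
    and disj: "disjoint_family_on A {..m}"
    and \<kappa>: "\<And>i. \<kappa> i \<in> {1, 2}"
  shows "s \<le> card {x\<in>A m. \<exists>f. f m = x \<and> (\<forall>i\<le>m. f i \<in> A i) \<and> (\<forall>i<m. c {f i, f (Suc i)} = \<kappa> i)}"
  using A disj
proof (induction m)
  case 0
  have "A 0 = {x \<in> A 0. \<exists>f. f 0 = x \<and> (\<forall>i\<le>0. f i \<in> A i) \<and> (\<forall>i<0. c {f i, f (Suc i)} = \<kappa> i)}"
    by (auto intro: exI[of _ "\<lambda>_. _"])
  then show ?case using 0(2)[of 0] by simp
next
  case (Suc m)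
  define R where "R = {x\<in>A m. \<exists>f. f m = x \<and> (\<forall>i\<le>m. f i \<in> A i) \<and> (\<forall>i<m. c {f i, f (Suc i)} = \<kappa> i)}"
  define R' where "R' = {x\<in>A (Suc m). \<exists>f. f (Suc m) = x \<and> (\<forall>i\<le>Suc m. f i \<in> A i) \<and>
      (\<forall>i<Suc m. c {f i, f (Suc i)} = \<kappa> i)}"
  have R: "s \<le> card R"
    unfolding R_def using Suc.prems
    by (intro Suc.IH) (auto intro: disjoint_family_on_mono[rotated])
  have "R \<subseteq> A m" by (auto simp: R_def)
  moreover have "A m \<inter> A (Suc m) = {}"
    using Suc.prems(3) by (auto simp: disjoint_family_on_def)
  ultimately have sub: "R \<subseteq> {1..n}" "A (Suc m) - R' \<subseteq> {1..n}" "R \<inter> (A (Suc m) - R') = {}"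
    using Suc.prems(1)[of m] Suc.prems(1)[of "Suc m"] by auto
  have "card (A (Suc m) - R') < s"
  proof (rule ccontr)
    assume "\<not> ?thesis"
    then obtain x y where xy: "x \<in> R" "y \<in> A (Suc m) - R'" "c {x, y} = \<kappa> m"
      using bc sub R \<kappa>[of m] unfolding both_colors_between_sets_def by (meson not_less)
    obtain f where f: "f m = x" "\<And>i. i \<le> m \<Longrightarrow> f i \<in> A i" "\<And>i. i < m \<Longrightarrow> c {f i, f (Suc i)} = \<kappa> i"
      using xy(1) by (auto simp: R_def)
    have "y \<in> R'"
      unfolding R'_def using xy f
      by (auto intro!: exI[of _ "f(Suc m := y)"] simp: le_Suc_eq less_Suc_eq)
    then show False using xy by simp
  qed
  moreover have "card (A (Suc m) - R') = card (A (Suc m)) - card R'"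
    using Suc.prems(1)[of "Suc m"] by (intro card_Diff_subset) (auto simp: R'_def intro: finite_subset)
  ultimately show ?case
    using Suc.prems(2)[of "Suc m"] unfolding R'_def[symmetric] by linarith
qed

text \<open>Greedy choice: each transversal uses one vertex of each set, so after \<open>q\<close>
  of them have been removed at least \<open>2 * s\<close> vertices of each set are left and another
  transversal exists.\<close>

lemma ex_disjoint_transversals:
  assumes bc: "both_colors_between_sets s n c" and s: "s \<ge> 1"
    and A: "\<And>i. i \<le> m \<Longrightarrow> A i \<subseteq> {1..n}" "\<And>i. i \<le> m \<Longrightarrow> q + 2 * s \<le> card (A i)"
    and disj: "disjoint_family_on A {..m}"
    and \<kappa>: "\<And>i. \<kappa> i \<in> {1, 2}"
  shows "\<exists>F. (\<forall>j<q. \<forall>i\<le>m. F j i \<in> A i) \<and> (\<forall>j<q. \<forall>i<m. c {F j i, F j (Suc i)} = \<kappa> i) \<and>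
             (\<forall>i\<le>m. inj_on (\<lambda>j. F j i) {..<q})"
  using A(2)
proof (induction q)
  case 0
  then show ?case by auto
next
  case (Suc q)
  have "\<exists>F. (\<forall>j<q. \<forall>i\<le>m. F j i \<in> A i) \<and> (\<forall>j<q. \<forall>i<m. c {F j i, F j (Suc i)} = \<kappa> i) \<and>
             (\<forall>i\<le>m. inj_on (\<lambda>j. F j i) {..<q})"
    using Suc.prems by (intro Suc.IH) fastforce
  then obtain F
    where F': "\<forall>j<q. \<forall>i\<le>m. F j i \<in> A i" "\<forall>j<q. \<forall>i<m. c {F j i, F j (Suc i)} = \<kappa> i"
      "\<forall>i\<le>m. inj_on (\<lambda>j. F j i) {..<q}"
    by (elim exE conjE)
  have F: "\<And>j i. j < q \<Longrightarrow> i \<le> m \<Longrightarrow> F j i \<in> A i"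
      "\<And>j i. j < q \<Longrightarrow> i < m \<Longrightarrow> c {F j i, F j (Suc i)} = \<kappa> i"
      "\<And>i. i \<le> m \<Longrightarrow> inj_on (\<lambda>j. F j i) {..<q}"
    using F' by simp_all
  define A' where "A' = (\<lambda>i. A i - (\<lambda>j. F j i) ` {..<q})"
  have card': "2 * s \<le> card (A' i)" if "i \<le> m" for i
  proof -
    have "card ((\<lambda>j. F j i) ` {..<q}) \<le> q"
      using card_image_le[of "{..<q}"] by simp
    moreover have "card (A' i) \<ge> card (A i) - card ((\<lambda>j. F j i) ` {..<q})"
      unfolding A'_def by (rule diff_card_le_card_Diff) simp
    ultimately show ?thesis using Suc.prems[OF that] by linarith
  qed
  have "s \<le> card {x\<in>A' m. \<exists>f. f m = x \<and> (\<forall>i\<le>m. f i \<in> A' i) \<and> (\<forall>i<m. c {f i, f (Suc i)} = \<kappa> i)}"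
  proof (rule card_reachable_by_transversal[OF bc _ card' _ \<kappa>])
    show "A' i \<subseteq> {1..n}" if "i \<le> m" for i
      using A(1)[OF that] by (auto simp: A'_def)
    show "disjoint_family_on A' {..m}"
      using disj unfolding disjoint_family_on_def A'_def by blast
  qed
  with s have "{x\<in>A' m. \<exists>f. f m = x \<and> (\<forall>i\<le>m. f i \<in> A' i) \<and> (\<forall>i<m. c {f i, f (Suc i)} = \<kappa> i)} \<noteq> {}"
    by (metis card.empty not_one_le_zero le_trans)
  then obtain f where f: "\<And>i. i \<le> m \<Longrightarrow> f i \<in> A' i" "\<And>i. i < m \<Longrightarrow> c {f i, f (Suc i)} = \<kappa> i"
    by blast
  show ?case
  proof (intro exI[of _ "F(q := f)"] conjI allI impI)
    fix i assume "i \<le> m"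
    then show "inj_on (\<lambda>j. (F(q := f)) j i) {..<Suc q}"
      using F(3)[of i] f(1)[of i]
      by (auto simp: lessThan_Suc A'_def inj_on_def image_iff) (metis lessThan_iff)+
  qed (use F f in \<open>auto simp: less_Suc_eq A'_def\<close>)
qed

text \<open>Edge number \<open>i\<close> of each path gets color \<open>\<kappa> i\<close>: the
  hypotheses on \<open>u\<close> and \<open>v\<close> settle the first and last edges, transversals
  of the \<open>m + 1\<close> sets supply the others. Recording that the paths stay inside the sets
  allows two families to be united later.\<close>

lemma ex_alternating_paths_through_sets:
  assumes bc: "both_colors_between_sets s n c" and s: "s \<ge> 1"
    and uv: "u \<in> {1..n}" "v \<in> {1..n}" "u \<noteq> v"
    and A: "\<And>i. i \<le> m \<Longrightarrow> A i \<subseteq> {1..n} - {u, v}" "\<And>i. i \<le> m \<Longrightarrow> q + 2 * s \<le> card (A i)"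
    and disj: "disjoint_family_on A {..m}"
    and \<kappa>: "\<And>i. \<kappa> i \<in> {1, 2}" "\<And>i. \<kappa> i \<noteq> \<kappa> (Suc i)"
    and u: "\<And>x. x \<in> A 0 \<Longrightarrow> c {u, x} = \<kappa> 0" and v: "\<And>x. x \<in> A m \<Longrightarrow> c {v, x} = \<kappa> (Suc m)"
  shows "\<exists>P. finite P \<and> card P = q \<and> internally_disjoint u v P \<and>
    (\<forall>p\<in>P. path_between (complete_graph n) (m + 2) u v p \<and> alternating c p \<and>
           set p \<subseteq> {u, v} \<union> (\<Union>i\<le>m. A i))"
proof -
  have "\<exists>F. (\<forall>j<q. \<forall>i\<le>m. F j i \<in> A i) \<and> (\<forall>j<q. \<forall>i<m. c {F j i, F j (Suc i)} = \<kappa> (Suc i)) \<and>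
             (\<forall>i\<le>m. inj_on (\<lambda>j. F j i) {..<q})"
    using A(1) by (intro ex_disjoint_transversals[OF bc s _ A(2) disj \<kappa>(1)]) auto
  then obtain F
    where F': "\<forall>j<q. \<forall>i\<le>m. F j i \<in> A i" "\<forall>j<q. \<forall>i<m. c {F j i, F j (Suc i)} = \<kappa> (Suc i)"
      "\<forall>i\<le>m. inj_on (\<lambda>j. F j i) {..<q}"
    by (elim exE conjE)
  have F: "\<And>j i. j < q \<Longrightarrow> i \<le> m \<Longrightarrow> F j i \<in> A i"
      "\<And>j i. j < q \<Longrightarrow> i < m \<Longrightarrow> c {F j i, F j (Suc i)} = \<kappa> (Suc i)"
      "\<And>i. i \<le> m \<Longrightarrow> inj_on (\<lambda>j. F j i) {..<q}"
    using F' by simp_all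
  have Adisj: "i = i'" if "x \<in> A i" "x \<in> A i'" "i \<le> m" "i' \<le> m" for x i i'
    using disj that unfolding disjoint_family_on_def by blast
  \<comment> \<open>\<open>g j i\<close> is the vertex at position \<open>i\<close> of path
    \<open>j\<close>. Position 0 is \<open>u\<close>, so the inner vertices are shifted by one
    against \<open>F j\<close>, and the transversals were requested with colors
    \<open>\<kappa> (Suc i)\<close>.\<close>
  define g where "g = (\<lambda>j i. if i = 0 then u else if i \<le> Suc m then F j (i - 1) else v)"
  define p where "p = (\<lambda>j. map (g j) [0..<m + 3])"
  have nth: "p j ! i = g j i" if "i < m + 3" for i j
    using that by (simp add: p_def del: upt_Suc)
  have FV: "F j i \<in> {1..n}" "F j i \<noteq> u" "F j i \<noteq> v" if "j < q" "i \<le> m" for j i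
    using F(1)[OF that] A(1)[OF that(2)] by auto
  have color: "c {g j i, g j (Suc i)} = \<kappa> i" if "j < q" "i < m + 2" for j i
  proof -
    have "i = 0 \<or> (i = Suc (i - 1) \<and> i - 1 < m) \<or> i = Suc m"
      using that(2) by linarith
    then consider "i = 0" | i' where "i = Suc i'" "i' < m" | "i = Suc m"
      by metis
    then show ?thesis
    proof cases
      case 1
      then show ?thesis using u[OF F(1)[OF that(1), of 0]] by (simp add: g_def)
    next
      case 2
      then show ?thesis using F(2)[OF that(1)] by (simp add: g_def)
    next
      case 3
      then show ?thesis using v[OF F(1)[OF that(1), of m]] by (simp add: g_def insert_commute)
    qed
  qed
  have inj: "inj_on (g j) {0..<m + 3}" if "j < q" for j
  proof (rule inj_onI)
    fix i i' assume i: "i \<in> {0..<m + 3}" "i' \<in> {0..<m + 3}" "g j i = g j i'"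
    have "i = 0 \<or> (1 \<le> i \<and> i \<le> Suc m) \<or> i = m + 2" using i(1) by fastforce
    moreover have "i' = 0 \<or> (1 \<le> i' \<and> i' \<le> Suc m) \<or> i' = m + 2" using i(2) by fastforce
    moreover have "i - 1 = i' - 1" if "1 \<le> i \<and> i \<le> Suc m" "1 \<le> i' \<and> i' \<le> Suc m"
    proof -
      have "F j (i - 1) = F j (i' - 1)" using that i(3) by (simp add: g_def)
      then show ?thesis
        using F(1)[OF \<open>j < q\<close>, of "i - 1"] F(1)[OF \<open>j < q\<close>, of "i' - 1"] that
        by (intro Adisj[of "F j (i - 1)"]) auto
    qed
    ultimately show "i = i'"
      using i(3) uv(3) FV[OF that, of "i - 1"] FV[OF that, of "i' - 1"]
      by (elim disjE) (auto simp: g_def le_diff_conv)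
  qed
  have setp: "set (p j) = {u, v} \<union> F j ` {..m}" for j
  proof -
    have "{0..<m + 3} = insert 0 (insert (m + 2) {1..Suc m})" by auto
    then have "{0..<m + 3} = insert 0 (insert (m + 2) (Suc ` {..m}))"
      by (simp only: image_Suc_atMost)
    then have "set (p j) = insert (g j 0) (insert (g j (m + 2)) ((\<lambda>i. g j (Suc i)) ` {..m}))"
      by (simp only: p_def set_map set_upt image_insert image_image)
    moreover have "(\<lambda>i. g j (Suc i)) ` {..m} = F j ` {..m}"
      by (intro image_cong) (auto simp: g_def)
    ultimately show ?thesis by (simp add: g_def)
  qed
  have path: "path_between (complete_graph n) (m + 2) u v (p j)" if j: "j < q" for j
    unfolding path_between_def
  proof (intro conjI allI impI)
    show "length (p j) = m + 2 + 1" by (simp add: p_def del: upt_Suc)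
    show "hd (p j) = u" by (simp add: p_def hd_map g_def del: upt_Suc)
    show "last (p j) = v" by (simp add: p_def last_map g_def)
    show "distinct (p j)" using inj[OF j] by (simp add: p_def distinct_map del: upt_Suc)
    show sub: "set (p j) \<subseteq> fst (complete_graph n)"
      using uv FV(1)[OF j] by (auto simp: setp complete_graph_def)
    fix i assume i: "i < m + 2"
    have "g j i \<in> set (p j)" "g j (Suc i) \<in> set (p j)"
      using i by (auto simp: p_def simp del: upt_Suc)
    moreover have "g j i \<noteq> g j (Suc i)"
      using inj_onD[OF inj[OF j], of i "Suc i"] i by auto
    ultimately show "{p j ! i, p j ! (i + 1)} \<in> snd (complete_graph n)"
      using sub i by (auto simp: nth complete_graph_def)
  qed
  have alt: "alternating c (p j)" if j: "j < q" for j
    unfolding alternating_def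
  proof (intro allI impI)
    fix i assume "i + 2 < length (p j)"
    then have "i < m + 1" by (simp add: p_def del: upt_Suc)
    then show "c {p j ! i, p j ! (i + 1)} \<noteq> c {p j ! (i + 1), p j ! (i + 2)}"
      using color[OF j, of i] color[OF j, of "Suc i"] \<kappa>(2)[of i] by (simp add: nth)
  qed
  have disjF: "F j i \<noteq> F j' i'" if "j < q" "j' < q" "j \<noteq> j'" "i \<le> m" "i' \<le> m" for j j' i i'
  proof
    assume eq: "F j i = F j' i'"
    then have "i = i'"
      using F(1)[of j i] F(1)[of j' i'] that by (intro Adisj[of "F j i"]) auto
    then show False using eq F(3)[of i] that by (auto dest: inj_onD)
  qed
  have "inj_on p {..<q}"
  proof (rule inj_onI)
    fix j j' assume "j \<in> {..<q}" "j' \<in> {..<q}" "p j = p j'"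
    then have "F j 0 = F j' 0" using nth[of 1 j] nth[of 1 j'] by (simp add: g_def)
    then show "j = j'" using disjF[of j j' 0 0] \<open>j \<in> {..<q}\<close> \<open>j' \<in> {..<q}\<close> by auto
  qed
  then have "card (p ` {..<q}) = q" by (simp add: card_image)
  moreover have "internally_disjoint u v (p ` {..<q})"
    unfolding internally_disjoint_def
  proof (intro ballI impI)
    fix x y assume "x \<in> p ` {..<q}" "y \<in> p ` {..<q}" "x \<noteq> y"
    then obtain j j' where "j < q" "j' < q" "x = p j" "y = p j'" "j \<noteq> j'" by auto
    then show "set x \<inter> set y \<subseteq> {u, v}"
      using disjF[of j j'] by (auto simp: setp)
  qed
  ultimately show ?thesis
    using path alt F(1) by (intro exI[of _ "p ` {..<q}"]) (auto simp: setp)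
qed

section \<open>Choosing the sets of inner vertices\<close>

lemma obtain_disjoint_subsets:
  assumes "finite X" "k * Q \<le> card X"
  obtains B :: "nat \<Rightarrow> 'a set"
  where "\<And>i. i < k \<Longrightarrow> B i \<subseteq> X" "\<And>i. i < k \<Longrightarrow> card (B i) = Q" "disjoint_family_on B {..<k}"
proof -
  have "\<exists>B :: nat \<Rightarrow> 'a set. (\<forall>i<k. B i \<subseteq> X \<and> card (B i) = Q) \<and> disjoint_family_on B {..<k}"
    using assms
  proof (induction k arbitrary: X)
    case 0
    then show ?case by (auto simp: disjoint_family_on_def)
  next
    case (Suc k)
    obtain Y where Y: "Y \<subseteq> X" "card Y = Q"
      using Suc.prems by (metis add_leD1 mult_Suc obtain_subset_with_card_n)
    have "k * Q \<le> card (X - Y)"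
      using Suc.prems Y by (simp add: card_Diff_subset finite_subset)
    then obtain B where B: "\<And>i. i < k \<Longrightarrow> B i \<subseteq> X - Y \<and> card (B i) = Q" "disjoint_family_on B {..<k}"
      using Suc.IH[of "X - Y"] Suc.prems(1) by blast
    have "disjoint_family_on (B(k := Y)) {..<Suc k}"
      using B unfolding disjoint_family_on_def by (auto simp: less_Suc_eq) blast+
    moreover have "\<forall>i<Suc k. (B(k := Y)) i \<subseteq> X \<and> card ((B(k := Y)) i) = Q"
      using B Y by (auto simp: less_Suc_eq)
    ultimately show ?case by blast
  qed
  then show ?thesis using that by blast
qed

lemma joint_type_subset: "joint_type n c u v i j \<subseteq> {1..n} - {u, v}"
  by (auto simp: joint_type_def)

lemma finite_joint_type [simp]: "finite (joint_type n c u v i j)"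
  by (rule finite_subset[OF joint_type_subset]) simp

lemma joint_type_disjoint:
  "i \<noteq> i' \<or> j \<noteq> j' \<Longrightarrow> joint_type n c u v i j \<inter> joint_type n c u v i' j' = {}"
  by (auto simp: joint_type_def)

text \<open>The set \<open>X\<close> will be joined to \<open>u\<close> in color 1 and \<open>Y\<close> to \<open>v\<close> in color \<open>x\<close>.
  Splitting the type \<open>(1, x)\<close>, which is eligible for both, makes them equally large.\<close>

lemma obtain_end_sets:
  assumes "x \<noteq> y" "2 * \<tau> \<le> card (joint_type n c u v 1 x)" "2 * \<tau> \<le> card (joint_type n c u v 1 y)"
    "2 * \<tau> \<le> card (joint_type n c u v 2 x)"
  obtains X Y where "X \<inter> Y = {}" "card X = 3 * \<tau>" "card Y = 3 * \<tau>"
    "X \<subseteq> joint_type n c u v 1 x \<union> joint_type n c u v 1 y"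
    "Y \<subseteq> joint_type n c u v 1 x \<union> joint_type n c u v 2 x"
proof -
  \<comment> \<open>Each side receives \<open>\<tau>\<close> vertices of the shared type
    \<open>(1, x)\<close> and \<open>2 * \<tau>\<close> of a type of its own, hence
    \<open>3 * \<tau>\<close>.\<close>
  obtain B :: "nat \<Rightarrow> nat set" where B: "\<And>i. i < 2 \<Longrightarrow> B i \<subseteq> joint_type n c u v 1 x"
      "\<And>i. i < 2 \<Longrightarrow> card (B i) = \<tau>" "disjoint_family_on B {..<2}"
    using obtain_disjoint_subsets[OF finite_joint_type assms(2)] by blast
  have B01: "B 0 \<inter> B 1 = {}"
    using B(3) by (auto simp: disjoint_family_on_def)
  obtain X' where X': "X' \<subseteq> joint_type n c u v 1 y" "card X' = 2 * \<tau>" "finite X'"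
    using obtain_subset_with_card_n[OF assms(3)] by blast
  obtain Y' where Y': "Y' \<subseteq> joint_type n c u v 2 x" "card Y' = 2 * \<tau>" "finite Y'"
    using obtain_subset_with_card_n[OF assms(4)] by blast
  have fin: "finite (B 0)" "finite (B 1)"
    using B(1)[of 0] B(1)[of 1] by (auto intro: finite_subset)
  have d: "joint_type n c u v 1 x \<inter> joint_type n c u v 1 y = {}"
    "joint_type n c u v 1 x \<inter> joint_type n c u v 2 x = {}"
    "joint_type n c u v 1 y \<inter> joint_type n c u v 2 x = {}"
    using assms(1) by (simp_all add: joint_type_disjoint)
  have sub: "B 0 \<subseteq> joint_type n c u v 1 x" "B 1 \<subseteq> joint_type n c u v 1 x"
    by (rule B(1); simp)+
  show thesis
  proof
    show "(B 0 \<union> X') \<inter> (B 1 \<union> Y') = {}"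
      using sub B01 X'(1) Y'(1) d by blast
    have "B 0 \<inter> X' = {}" "B 1 \<inter> Y' = {}"
      using sub X'(1) Y'(1) d by blast+
    then show "card (B 0 \<union> X') = 3 * \<tau>" "card (B 1 \<union> Y') = 3 * \<tau>"
      using fin X' Y' B(2)[of 0] B(2)[of 1] by (simp_all add: card_Un_disjoint)
  qed (use sub X'(1) Y'(1) in blast)+
qed

text \<open>For the cardinality, a path in both families would have all its vertices in
  \<open>{u, v}\<close>, which is impossible for a list with three distinct entries.\<close>

lemma internally_disjoint_Un:
  assumes P: "finite P" "internally_disjoint u v P" "\<And>p. p \<in> P \<Longrightarrow> set p \<subseteq> {u, v} \<union> S"
    and Q: "finite Q" "internally_disjoint u v Q" "\<And>p. p \<in> Q \<Longrightarrow> set p \<subseteq> {u, v} \<union> T"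
    and ST: "S \<inter> T = {}" and long: "\<And>p. p \<in> P \<Longrightarrow> distinct p \<and> length p \<ge> 3"
  shows "internally_disjoint u v (P \<union> Q)" "card (P \<union> Q) = card P + card Q"
proof -
  have PQ: "set p \<inter> set q \<subseteq> {u, v}" if "p \<in> P" "q \<in> Q" for p q
    using P(3)[OF that(1)] Q(3)[OF that(2)] ST by blast
  show "internally_disjoint u v (P \<union> Q)"
    using P(2) Q(2) PQ unfolding internally_disjoint_def by (metis Int_commute Un_iff)
  have "p \<notin> Q" if p: "p \<in> P" for p
  proof
    assume "p \<in> Q"
    then have "card (set p) \<le> card {u, v}"
      using PQ[OF p] by (intro card_mono) auto
    moreover have "card (set p) \<ge> 3"
      using long[OF p] by (simp add: distinct_card)
    moreover have "card {u, v} \<le> 2"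
      by (simp add: card_insert_if)
    ultimately show False by linarith
  qed
  then show "card (P \<union> Q) = card P + card Q"
    using P(1) Q(1) by (intro card_Un_disjoint) auto
qed

section \<open>Connecting all pairs by paths of length at least three\<close>

text \<open>In the application \<open>8 * \<tau>\<close> is close to \<open>n\<close>, so that
  \<open>4 * \<tau>\<close> is close to the optimum \<open>n / 2\<close>. Paths colored 1, 2, 1 use
  the types \<open>(1, 1)\<close>, \<open>(1, 2)\<close> and \<open>(2, 1)\<close>; vertices of type
  \<open>(2, 2)\<close> cannot serve in them, as they see both ends in color 2.\<close>

lemma alternating_connected_3:
  assumes bc: "both_colors_between_sets s n c" and s: "s \<ge> 1"
    and types: "\<And>u v i j. u \<in> {1..n} \<Longrightarrow> v \<in> {1..n} \<Longrightarrow> u \<noteq> v \<Longrightarrow> i \<in> {1, 2} \<Longrightarrow> j \<in> {1, 2} \<Longrightarrow>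
      2 * \<tau> \<le> card (joint_type n c u v i j)"
    and \<tau>: "2 * s \<le> \<tau>"
  shows "alternating_connected 3 (complete_graph n) c (4 * \<tau> - 4 * s)"
  unfolding alternating_connected_def
proof (intro ballI impI)
  fix u v assume "u \<in> fst (complete_graph n)" "v \<in> fst (complete_graph n)" "u \<noteq> v"
  then have uv: "u \<in> {1..n}" "v \<in> {1..n}" "u \<noteq> v" by (auto simp: complete_graph_def)
  let ?T = "joint_type n c u v"
  obtain X Y where XY: "X \<inter> Y = {}" "card X = 3 * \<tau>" "card Y = 3 * \<tau>"
    "X \<subseteq> ?T 1 1 \<union> ?T 1 2" "Y \<subseteq> ?T 1 1 \<union> ?T 2 1"
    using types[OF uv] by (auto intro: obtain_end_sets[of 1 2 \<tau> n c u v])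
  obtain B :: "nat \<Rightarrow> nat set" where B: "\<And>i. i < 2 \<Longrightarrow> B i \<subseteq> ?T 2 2"
      "\<And>i. i < 2 \<Longrightarrow> card (B i) = \<tau>" "disjoint_family_on B {..<2}"
    using obtain_disjoint_subsets[OF finite_joint_type types[OF uv, of 2 2]] by blast
  define A where "A = (\<lambda>i::nat. if i = 0 then X else Y)"
  have three: "1 + 2 = (3::nat)" by simp
  have "\<exists>P. finite P \<and> card P = 3 * \<tau> - 2 * s \<and> internally_disjoint u v P \<and>
    (\<forall>p\<in>P. path_between (complete_graph n) (1 + 2) u v p \<and> alternating c p \<and>
           set p \<subseteq> {u, v} \<union> (\<Union>i\<le>1. A i))"
  proof (rule ex_alternating_paths_through_sets[OF bc s uv, where \<kappa> = "\<lambda>i. if even i then 1 else 2"])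
    fix i :: nat assume "i \<le> 1"
    then show "A i \<subseteq> {1..n} - {u, v}"
      using XY(4,5) by (auto simp: A_def joint_type_def)
    show "3 * \<tau> - 2 * s + 2 * s \<le> card (A i)"
      using XY \<tau> by (simp add: A_def)
  next
    show "disjoint_family_on A {..1}"
      using XY(1) by (auto simp: disjoint_family_on_def A_def)
  qed (use XY(4,5) in \<open>auto simp: A_def joint_type_def\<close>)
  then obtain P where P: "finite P" "card P = 3 * \<tau> - 2 * s" "internally_disjoint u v P"
    "\<And>p. p \<in> P \<Longrightarrow> path_between (complete_graph n) 3 u v p \<and> alternating c p \<and>
           set p \<subseteq> {u, v} \<union> (\<Union>i\<le>1. A i)"
    unfolding three by metis
  \<comment> \<open>The second family, colored 2, 1, 2, runs between two halves of type
    \<open>(2, 2)\<close>, which the first family leaves untouched.\<close>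
  have "\<exists>P. finite P \<and> card P = \<tau> - 2 * s \<and> internally_disjoint u v P \<and>
    (\<forall>p\<in>P. path_between (complete_graph n) (1 + 2) u v p \<and> alternating c p \<and>
           set p \<subseteq> {u, v} \<union> (\<Union>i\<le>1. B i))"
  proof (rule ex_alternating_paths_through_sets[OF bc s uv, where \<kappa> = "\<lambda>i. if even i then 2 else 1"])
    fix i :: nat assume i: "i \<le> 1"
    then show "B i \<subseteq> {1..n} - {u, v}"
      using B(1)[of i] joint_type_subset[of n c u v] by fastforce
    show "\<tau> - 2 * s + 2 * s \<le> card (B i)"
      using B(2)[of i] i \<tau> by simp
  next
    show "disjoint_family_on B {..1}"
      using B(3) by (auto simp: disjoint_family_on_def)
  next
    show "c {u, x} = (if even 0 then 2 else 1)" if "x \<in> B 0" for x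
      using that B(1)[of 0] by (auto simp: joint_type_def)
    show "c {v, x} = (if even (Suc 1) then 2 else 1)" if "x \<in> B 1" for x
      using that B(1)[of 1] by (auto simp: joint_type_def)
  qed auto
  then obtain Q where Q: "finite Q" "card Q = \<tau> - 2 * s" "internally_disjoint u v Q"
    "\<And>p. p \<in> Q \<Longrightarrow> path_between (complete_graph n) 3 u v p \<and> alternating c p \<and>
           set p \<subseteq> {u, v} \<union> (\<Union>i\<le>1. B i)"
    unfolding three by metis
  have "(\<Union>i\<le>1. A i) \<subseteq> ?T 1 1 \<union> ?T 1 2 \<union> ?T 2 1"
    using XY(4,5) by (auto simp: A_def)
  moreover have "(\<Union>i\<le>1. B i) \<subseteq> ?T 2 2"
    by (intro UN_least B(1)) auto
  moreover have "(?T 1 1 \<union> ?T 1 2 \<union> ?T 2 1) \<inter> ?T 2 2 = {}"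
    by (auto simp: joint_type_def)
  ultimately have AB: "(\<Union>i\<le>1. A i) \<inter> (\<Union>i\<le>1. B i) = {}"
    by blast
  have long: "distinct p \<and> 3 \<le> length p" if "p \<in> P" for p
    using P(4)[OF that] by (auto simp: path_between_def)
  have "internally_disjoint u v (P \<union> Q)" "card (P \<union> Q) = card P + card Q"
    by (rule internally_disjoint_Un[OF P(1,3) _ Q(1,3) _ AB]; use P(4) Q(4) long in blast)+
  then show "\<exists>P. finite P \<and> card P = 4 * \<tau> - 4 * s \<and> internally_disjoint u v P \<and>
             (\<forall>p\<in>P. path_between (complete_graph n) 3 u v p \<and> alternating c p)"
    using P Q \<tau> by (intro exI[of _ "P \<union> Q"]) auto
qed

text \<open>A single family suffices when the common size \<open>Q\<close> of the
  \<open>m + 1\<close> inner sets is at most \<open>3 * \<tau>\<close>: only the first and last set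
  are tied to joint types, and the intermediate ones are cut arbitrarily from the remaining
  vertices.\<close>

lemma alternating_connected_ge_3:
  assumes bc: "both_colors_between_sets s n c" and s: "s \<ge> 1"
    and types: "\<And>u v i j. u \<in> {1..n} \<Longrightarrow> v \<in> {1..n} \<Longrightarrow> u \<noteq> v \<Longrightarrow> i \<in> {1, 2} \<Longrightarrow> j \<in> {1, 2} \<Longrightarrow>
      2 * \<tau> \<le> card (joint_type n c u v i j)"
    and m: "m \<ge> 1" and Q: "Q \<le> 3 * \<tau>" "(m + 1) * Q \<le> n - 2" and q: "q + 2 * s \<le> Q"
  shows "alternating_connected (m + 2) (complete_graph n) c q"
  unfolding alternating_connected_def
proof (intro ballI impI)
  fix u v assume "u \<in> fst (complete_graph n)" "v \<in> fst (complete_graph n)" "u \<noteq> v"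
  then have uv: "u \<in> {1..n}" "v \<in> {1..n}" "u \<noteq> v" by (auto simp: complete_graph_def)
  let ?T = "joint_type n c u v"
  define \<kappa> :: "nat \<Rightarrow> nat" where "\<kappa> = (\<lambda>i. if even i then 1 else 2)"
  \<comment> \<open>The last edge has color \<open>x\<close>, determined by the parity of the path
    length; \<open>3 - x\<close> is the other color.\<close>
  define x where "x = \<kappa> (Suc m)"
  have x: "x \<in> {1, 2}" "3 - x \<in> {1, 2}" "x \<noteq> 3 - x" by (auto simp: x_def \<kappa>_def)
  obtain X Y where XY: "X \<inter> Y = {}" "card X = 3 * \<tau>" "card Y = 3 * \<tau>"
    "X \<subseteq> ?T 1 x \<union> ?T 1 (3 - x)" "Y \<subseteq> ?T 1 x \<union> ?T 2 x"
    using types[OF uv] x by (auto intro: obtain_end_sets[of x "3 - x" \<tau> n c u v])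
  obtain X' where X': "X' \<subseteq> X" "card X' = Q" "finite X'"
    using obtain_subset_with_card_n[of Q X] Q(1) XY by auto
  obtain Y' where Y': "Y' \<subseteq> Y" "card Y' = Q" "finite Y'"
    using obtain_subset_with_card_n[of Q Y] Q(1) XY by auto
  define R where "R = {1..n} - {u, v} - (X' \<union> Y')"
  have sub: "X' \<subseteq> {1..n} - {u, v}" "Y' \<subseteq> {1..n} - {u, v}"
    using X'(1) Y'(1) XY(4,5) joint_type_subset[of n c u v] by blast+
  have "card ({1..n} - {u, v}) = n - 2"
    using uv by (simp add: card_Diff_subset)
  moreover have "card (X' \<union> Y') = 2 * Q"
    using X' Y' XY(1) by (subst card_Un_disjoint) auto
  ultimately have "card R = n - 2 - 2 * Q"
    using X' Y' sub by (simp add: R_def card_Diff_subset)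
  moreover have "(m + 1) * Q = (m - 1) * Q + 2 * Q"
    using m by (cases m) (simp_all add: algebra_simps)
  ultimately have "(m - 1) * Q \<le> card R" using Q(2) by linarith
  moreover have "finite R" by (simp add: R_def)
  ultimately obtain B :: "nat \<Rightarrow> nat set" where B: "\<And>i. i < m - 1 \<Longrightarrow> B i \<subseteq> R"
      "\<And>i. i < m - 1 \<Longrightarrow> card (B i) = Q" "disjoint_family_on B {..<m - 1}"
    using obtain_disjoint_subsets[of R "m - 1" Q] by blast
  define A where "A = (\<lambda>i. if i = 0 then X' else if i = m then Y' else B (i - 1))"
  have "\<exists>P. finite P \<and> card P = q \<and> internally_disjoint u v P \<and>
    (\<forall>p\<in>P. path_between (complete_graph n) (m + 2) u v p \<and> alternating c p \<and>
           set p \<subseteq> {u, v} \<union> (\<Union>i\<le>m. A i))"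
  proof (rule ex_alternating_paths_through_sets[OF bc s uv, where \<kappa> = \<kappa>])
    fix i assume i: "i \<le> m"
    have "i - 1 < m - 1" if "i \<noteq> 0" "i \<noteq> m" using i that by linarith
    then show "A i \<subseteq> {1..n} - {u, v}" "q + 2 * s \<le> card (A i)"
      using sub B(1)[of "i - 1"] B(2)[of "i - 1"] q X' Y' by (auto simp: A_def R_def)
  next
    have X'Y': "X' \<inter> Y' = {}" using X' Y' XY(1) by blast
    have XB: "X' \<inter> B (i - 1) = {}" "Y' \<inter> B (i - 1) = {}" if "0 < i" "i < m" for i
    proof -
      have "B (i - 1) \<subseteq> R" using that by (intro B(1)) linarith
      then show "X' \<inter> B (i - 1) = {}" "Y' \<inter> B (i - 1) = {}" by (auto simp: R_def)
    qed
    have BB: "B (i - 1) \<inter> B (j - 1) = {}" if "0 < i" "i < m" "0 < j" "j < m" "i \<noteq> j" for i j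
    proof -
      have "i - 1 \<in> {..<m - 1}" "j - 1 \<in> {..<m - 1}" "i - 1 \<noteq> j - 1" using that by auto
      then show ?thesis using B(3) unfolding disjoint_family_on_def by blast
    qed
    show "disjoint_family_on A {..m}"
      unfolding disjoint_family_on_def
    proof (intro ballI impI)
      fix i j assume ij: "i \<in> {..m}" "j \<in> {..m}" "i \<noteq> j"
      have "i = 0 \<or> i = m \<or> (0 < i \<and> i < m)" "j = 0 \<or> j = m \<or> (0 < j \<and> j < m)"
        using ij by auto
      then show "A i \<inter> A j = {}"
        using X'Y' XB[of i] XB[of j] BB[of i j] ij(3) m
        by (elim disjE) (simp_all add: A_def Int_commute)
    qed
  next
    show "c {u, w} = \<kappa> 0" if "w \<in> A 0" for w
      using that X'(1) XY(4) by (auto simp: A_def \<kappa>_def joint_type_def)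
    show "c {v, w} = \<kappa> (Suc m)" if "w \<in> A m" for w
      using that Y'(1) XY(5) m unfolding x_def[symmetric] by (auto simp: A_def joint_type_def)
  qed (auto simp: \<kappa>_def)
  then show "\<exists>P. finite P \<and> card P = q \<and> internally_disjoint u v P \<and>
             (\<forall>p\<in>P. path_between (complete_graph n) (m + 2) u v p \<and> alternating c p)"
    by blast
qed

section \<open>Upper bounds and asymptotics\<close>

lemma alternating_connectivity_ge:
  assumes "n \<ge> 2" "r \<ge> 1" "edge_coloring r (complete_graph n) c"
    "alternating_connected l (complete_graph n) c t"
  shows "t \<le> alternating_connectivity r l (complete_graph n)"
  unfolding alternating_connectivity_def
proof (rule Max_ge)
  show "finite {t. \<exists>c. edge_coloring r (complete_graph n) c \<and> alternating_connected l (complete_graph n) c t}"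
    by (rule alternating_connectivity_max_exists(1)[of _ 1 2])
       (use assms in \<open>auto simp: complete_graph_def\<close>)
qed (use assms in blast)

lemma alternating_connectivity_attained:
  assumes "n \<ge> 2" "r \<ge> 1"
  obtains c where "edge_coloring r (complete_graph n) c"
    "alternating_connected l (complete_graph n) c (alternating_connectivity r l (complete_graph n))"
proof -
  let ?S = "{t. \<exists>c. edge_coloring r (complete_graph n) c \<and> alternating_connected l (complete_graph n) c t}"
  have "finite ?S" "?S \<noteq> {}"
    by (rule alternating_connectivity_max_exists[of _ 1 2];
        use assms in \<open>auto simp: complete_graph_def\<close>)+
  then have "Max ?S \<in> ?S" by (rule Max_in)
  then show ?thesis
    using that unfolding alternating_connectivity_def by blast
qed

section \<open>Upper bounds by counting\<close>

text \<open>A single pair of vertices suffices: the \<open>t\<close> paths joining 1 and 2 have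
  disjoint interiors of \<open>l - 1\<close> vertices each.\<close>

lemma alternating_connected_le:
  assumes conn: "alternating_connected l (complete_graph n) c t" and n: "n \<ge> 2"
  shows "t * (l - 1) \<le> n"
proof -
  have "(1::nat) \<in> fst (complete_graph n)" "2 \<in> fst (complete_graph n)"
    using n by (auto simp: complete_graph_def)
  then obtain P where P: "finite P" "card P = t" "internally_disjoint 1 2 P"
      "\<And>p. p \<in> P \<Longrightarrow> path_between (complete_graph n) l 1 2 p"
    using conn unfolding alternating_connected_def by (metis n_not_Suc_n Suc_1)
  have card: "card (set p - {1, 2}) = l - 1" if "p \<in> P" for p
  proof -
    have p: "length p = l + 1" "hd p = 1" "last p = 2" "distinct p"
      using P(4)[OF that] by (auto simp: path_between_def)
    then have "p \<noteq> []" by auto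
    then have "1 \<in> set p" "2 \<in> set p" using p by (metis hd_in_set, metis last_in_set)
    then show ?thesis using p by (simp add: card_Diff_subset distinct_card)
  qed
  have "t * (l - 1) = (\<Sum>p\<in>P. card (set p - {1, 2}))"
    using card P(2) by simp
  also have "\<dots> = card (\<Union>p\<in>P. set p - {1, 2})"
    using P(1,3) by (intro card_UN_disjoint[symmetric]) (auto simp: internally_disjoint_def)
  also have "\<dots> \<le> card {1..n}"
  proof (intro card_mono UN_least)
    show "set p - {1, 2} \<subseteq> {1..n}" if "p \<in> P" for p
      using P(4)[OF that] by (auto simp: path_between_def complete_graph_def)
  qed simp
  finally show ?thesis by simp
qed

text \<open>By Cauchy-Schwarz, the squares of the sizes of the \<open>r\<close> color classes add up
  to at least \<open>card S ^ 2 / r\<close>, and this sum counts the monochromatic ordered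
  pairs.\<close>

lemma card_bichromatic_pairs_le:
  assumes "finite S" "f ` S \<subseteq> {1..r}" "r \<ge> 1"
  shows "real (card {(x, y). x \<in> S \<and> y \<in> S \<and> f x \<noteq> f y}) \<le> (1 - 1 / real r) * real (card S) ^ 2"
proof -
  define D where "D = (\<lambda>i. {x\<in>S. f x = i})"
  have finD: "finite (D i)" for i using assms by (simp add: D_def)
  have S: "S = (\<Union>i\<in>{1..r}. D i)" using assms(2) by (auto simp: D_def)
  have cS: "card S = (\<Sum>i\<in>{1..r}. card (D i))"
    by (subst S, rule card_UN_disjoint) (auto simp: D_def assms(1))
  have mono: "{(x, y). x \<in> S \<and> y \<in> S \<and> f x = f y} = (\<Union>i\<in>{1..r}. D i \<times> D i)"
    using assms(2) by (auto simp: D_def)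
  have "card {(x, y). x \<in> S \<and> y \<in> S \<and> f x = f y} = (\<Sum>i\<in>{1..r}. card (D i \<times> D i))"
    unfolding mono by (rule card_UN_disjoint) (auto simp: finD, auto simp: D_def)
  then have cmono: "card {(x, y). x \<in> S \<and> y \<in> S \<and> f x = f y} = (\<Sum>i\<in>{1..r}. card (D i) ^ 2)"
    by (simp add: card_cartesian_product power2_eq_square)
  have "real (card S) ^ 2 \<le> (\<Sum>i\<in>{1..r}. real (card (D i)) ^ 2) * real r"
    using sum_squared_le_sum_of_squares[of "\<lambda>i. real (card (D i))" "{1..r}"] by (simp add: cS)
  then have "real (card S) ^ 2 / real r \<le> real (card {(x, y). x \<in> S \<and> y \<in> S \<and> f x = f y})"
    using assms(3) by (simp add: cmono field_simps)
  moreover have "card (S \<times> S) = card {(x, y). x \<in> S \<and> y \<in> S \<and> f x \<noteq> f y} +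
      card {(x, y). x \<in> S \<and> y \<in> S \<and> f x = f y}"
  proof -
    have "finite {(x, y). x \<in> S \<and> y \<in> S \<and> f x \<noteq> f y}"
      "finite {(x, y). x \<in> S \<and> y \<in> S \<and> f x = f y}"
      by (rule finite_subset[of _ "S \<times> S"]; use assms(1) in auto)+
    moreover have "S \<times> S = {(x, y). x \<in> S \<and> y \<in> S \<and> f x \<noteq> f y} \<union>
        {(x, y). x \<in> S \<and> y \<in> S \<and> f x = f y}"
      by auto
    ultimately show ?thesis by (simp only:) (rule card_Un_disjoint, auto)
  qed
  then have "real (card S * card S) = real (card {(x, y). x \<in> S \<and> y \<in> S \<and> f x \<noteq> f y} +
      card {(x, y). x \<in> S \<and> y \<in> S \<and> f x = f y})"
    by (simp only: card_cartesian_product)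
  then have "real (card {(x, y). x \<in> S \<and> y \<in> S \<and> f x \<noteq> f y}) +
      real (card {(x, y). x \<in> S \<and> y \<in> S \<and> f x = f y}) = real (card S) ^ 2"
    by (simp add: power2_eq_square)
  ultimately show ?thesis by (simp add: algebra_simps)
qed

text \<open>A path of length two between given ends is determined by its middle vertex.\<close>

lemma alternating_connected_2_card:
  assumes conn: "alternating_connected 2 (complete_graph n) c t"
    and uv: "u \<in> {1..n}" "v \<in> {1..n}" "u \<noteq> v"
  shows "t \<le> card {w\<in>{1..n}. w \<noteq> u \<and> w \<noteq> v \<and> c {w, u} \<noteq> c {w, v}}"
proof -
  have "u \<in> fst (complete_graph n)" "v \<in> fst (complete_graph n)"
    using uv by (auto simp: complete_graph_def)
  then obtain P where P: "finite P" "card P = t"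
      "\<And>p. p \<in> P \<Longrightarrow> path_between (complete_graph n) 2 u v p \<and> alternating c p"
    using conn uv(3) unfolding alternating_connected_def by metis
  have form: "\<exists>w. p = [u, w, v] \<and> w \<in> {1..n} \<and> w \<noteq> u \<and> w \<noteq> v \<and> c {w, u} \<noteq> c {w, v}"
    if "p \<in> P" for p
  proof -
    have pb: "length p = 3" "hd p = u" "last p = v" "distinct p" "set p \<subseteq> {1..n}" "alternating c p"
      using P(3)[OF that] by (auto simp: path_between_def complete_graph_def)
    then obtain w where p: "p = [u, w, v]"
      by (auto simp: length_Suc_conv numeral_3_eq_3)
    show ?thesis
      using pb unfolding p by (auto simp: alternating_def insert_commute)
  qed
  have "inj_on (\<lambda>p. p ! 1) P"
  proof (rule inj_onI)
    fix p q assume pq: "p \<in> P" "q \<in> P" "p ! 1 = q ! 1"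
    obtain w w' where "p = [u, w, v]" "q = [u, w', v]"
      using form[OF pq(1)] form[OF pq(2)] by blast
    then show "p = q" using pq(3) by simp
  qed
  then have "t = card ((\<lambda>p. p ! 1) ` P)"
    using P(2) by (simp add: card_image)
  also have "\<dots> \<le> card {w\<in>{1..n}. w \<noteq> u \<and> w \<noteq> v \<and> c {w, u} \<noteq> c {w, v}}"
  proof (intro card_mono image_subsetI)
    show "p ! 1 \<in> {w\<in>{1..n}. w \<noteq> u \<and> w \<noteq> v \<and> c {w, u} \<noteq> c {w, v}}" if "p \<in> P" for p
      using form[OF that] by auto
  qed simp
  finally show ?thesis .
qed

text \<open>Double counting of triples \<open>w, u, v\<close> in which \<open>w\<close> sees
  \<open>u\<close> and \<open>v\<close> in different colors. Each ordered pair of distinct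
  \<open>u, v\<close> lies in at least \<open>t\<close> of them, and each \<open>w\<close> in at
  most \<open>(1 - 1 / r) * (n - 1)^2\<close>.\<close>

lemma alternating_connected_2_le:
  assumes col: "edge_coloring r (complete_graph n) c"
    and conn: "alternating_connected 2 (complete_graph n) c t"
    and r: "r \<ge> 1" and n: "n \<ge> 2"
  shows "real t \<le> (1 - 1 / real r) * real n"
proof -
  define V where "V = {1..n}"
  have V: "finite V" "card V = n" by (auto simp: V_def)
  define h :: "nat \<Rightarrow> nat \<Rightarrow> nat \<Rightarrow> real"
    where "h = (\<lambda>w u v. of_bool (w \<noteq> u \<and> w \<noteq> v \<and> c {w, u} \<noteq> c {w, v}))"
  \<comment> \<open>The conditional term removes the diagonal, leaving \<open>n * (n - 1)\<close>
    ordered pairs.\<close>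
  have "real n * ((real n - 1) * real t) = (\<Sum>u\<in>V. \<Sum>v\<in>V. real t - (if u = v then real t else 0))"
    using V by (simp add: sum_subtractf algebra_simps)
  also have "\<dots> \<le> (\<Sum>u\<in>V. \<Sum>v\<in>V. \<Sum>w\<in>V. h w u v)"
  proof (intro sum_mono)
    fix u v assume uv: "u \<in> V" "v \<in> V"
    show "real t - (if u = v then real t else 0) \<le> (\<Sum>w\<in>V. h w u v)"
    proof (cases "u = v")
      case True
      then show ?thesis by (simp add: h_def)
    next
      case False
      have "(\<Sum>w\<in>V. h w u v) = real (card {w\<in>V. w \<noteq> u \<and> w \<noteq> v \<and> c {w, u} \<noteq> c {w, v}})"
        using V(1) by (simp only: h_def sum_of_bool_eq Int_def mem_Collect_eq)
      then show ?thesis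
        using alternating_connected_2_card[OF conn, of u v] uv False by (simp add: V_def)
    qed
  qed
  also have "\<dots> = (\<Sum>u\<in>V. \<Sum>w\<in>V. \<Sum>v\<in>V. h w u v)"
    by (rule sum.cong[OF refl], rule sum.swap)
  also have "\<dots> = (\<Sum>w\<in>V. \<Sum>u\<in>V. \<Sum>v\<in>V. h w u v)"
    by (rule sum.swap)
  also have "\<dots> \<le> (\<Sum>w\<in>V. (1 - 1 / real r) * (real n - 1) ^ 2)"
  proof (intro sum_mono)
    fix w assume w: "w \<in> V"
    have "(\<Sum>u\<in>V. \<Sum>v\<in>V. h w u v) = (\<Sum>x\<in>V \<times> V. h w (fst x) (snd x))"
      by (simp add: sum.cartesian_product case_prod_beta)
    also have "\<dots> = real (card (V \<times> V \<inter>
        {x. w \<noteq> fst x \<and> w \<noteq> snd x \<and> c {w, fst x} \<noteq> c {w, snd x}}))"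
      using V(1) by (simp only: h_def sum_of_bool_eq finite_cartesian_product)
    also have "V \<times> V \<inter> {x. w \<noteq> fst x \<and> w \<noteq> snd x \<and> c {w, fst x} \<noteq> c {w, snd x}} =
        {(x, y). x \<in> V - {w} \<and> y \<in> V - {w} \<and> c {w, x} \<noteq> c {w, y}}"
      by auto
    also have "real (card \<dots>) \<le> (1 - 1 / real r) * real (card (V - {w})) ^ 2"
    proof (rule card_bichromatic_pairs_le)
      show "(\<lambda>x. c {w, x}) ` (V - {w}) \<subseteq> {1..r}"
      proof (rule image_subsetI)
        fix x assume "x \<in> V - {w}"
        then have "{w, x} \<in> snd (complete_graph n)"
          using w by (auto simp: complete_graph_def V_def)
        then show "c {w, x} \<in> {1..r}" using col unfolding edge_coloring_def by blast
      qed
    qed (use V r in auto)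
    also have "real (card (V - {w})) = real n - 1"
      using V w n by (simp add: of_nat_diff)
    finally show "(\<Sum>u\<in>V. \<Sum>v\<in>V. h w u v) \<le> (1 - 1 / real r) * (real n - 1) ^ 2" .
  qed
  also have "\<dots> = real n * ((real n - 1) * ((1 - 1 / real r) * (real n - 1)))"
    by (simp add: V power2_eq_square)
  finally have "real t \<le> (1 - 1 / real r) * (real n - 1)"
    using n by (simp add: mult_le_cancel_left)
  also have "\<dots> \<le> (1 - 1 / real r) * real n"
    using r by (intro mult_left_mono) auto
  finally show ?thesis .
qed

section \<open>Lower bounds from quasirandom colorings\<close>

text \<open>The \<open>r * (r - 1)\<close> types with two different colors are disjoint, and each of
  their vertices is the middle of an alternating path.\<close>

lemma alternating_connected_2_quasirandom:
  assumes qr: "quasirandom_coloring r \<delta> n c" and r: "r \<ge> 1"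
    and t: "real t \<le> real r * (real r - 1) * ((1 / real r ^ 2 - \<delta>) * (real n - 2))"
  shows "alternating_connected 2 (complete_graph n) c t"
  unfolding alternating_connected_def
proof (intro ballI impI)
  fix u v assume "u \<in> fst (complete_graph n)" "v \<in> fst (complete_graph n)" "u \<noteq> v"
  then have uv: "u \<in> {1..n}" "v \<in> {1..n}" "u \<noteq> v" by (auto simp: complete_graph_def)
  define I where "I = (SIGMA i:{1..r}. {1..r} - {i})"
  define D where "D = {w\<in>{1..n} - {u, v}. c {u, w} \<noteq> c {v, w}}"
  have "card I = r * (r - 1)" by (simp add: I_def card_SigmaI)
  then have cI: "real (card I) = real r * (real r - 1)"
    using r by (simp add: of_nat_diff)
  have "real r * (real r - 1) * ((1 / real r ^ 2 - \<delta>) * (real n - 2))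
      = (\<Sum>(i, j)\<in>I. (1 / real r ^ 2 - \<delta>) * (real n - 2))"
    using cI by simp
  also have "\<dots> \<le> (\<Sum>(i, j)\<in>I. real (card (joint_type n c u v i j)))"
    using qr uv by (intro sum_mono) (auto simp: quasirandom_coloring_def I_def)
  also have "\<dots> = real (\<Sum>x\<in>I. card (joint_type n c u v (fst x) (snd x)))"
    by (simp add: case_prod_beta)
  also have "(\<Sum>x\<in>I. card (joint_type n c u v (fst x) (snd x)))
      = card (\<Union>x\<in>I. joint_type n c u v (fst x) (snd x))"
    by (rule card_UN_disjoint[symmetric]) (auto simp: I_def, auto simp: joint_type_def)
  also have "\<dots> \<le> card D"
    by (intro card_mono) (auto simp: D_def I_def joint_type_def)
  finally have "t \<le> card D" using t by linarith
  then obtain D' where D': "D' \<subseteq> D" "card D' = t" "finite D'"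
    by (rule obtain_subset_with_card_n)
  define P where "P = (\<lambda>w. [u, w, v]) ` D'"
  have "card P = t" unfolding P_def using D' by (subst card_image) (auto simp: inj_on_def)
  moreover have "internally_disjoint u v P"
    by (auto simp: internally_disjoint_def P_def)
  moreover have "path_between (complete_graph n) 2 u v p \<and> alternating c p" if p: "p \<in> P" for p
  proof -
    obtain w where w: "p = [u, w, v]" "w \<in> {1..n}" "w \<noteq> u" "w \<noteq> v" "c {u, w} \<noteq> c {v, w}"
      using p D'(1) by (auto simp: P_def D_def)
    have "{p ! i, p ! (i + 1)} \<in> snd (complete_graph n)" if "i < 2" for i
      using that w uv by (auto simp: less_2_cases_iff complete_graph_def)
    then show ?thesis
      using w uv by (auto simp: path_between_def alternating_def complete_graph_def insert_commute)
  qed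
  ultimately show "\<exists>P. finite P \<and> card P = t \<and> internally_disjoint u v P \<and>
             (\<forall>p\<in>P. path_between (complete_graph n) 2 u v p \<and> alternating c p)"
    using D'(3) by (intro exI[of _ P]) (auto simp: P_def)
qed

lemma eventually_real_ge: "eventually (\<lambda>n. K \<le> real n) sequentially"
  by (rule eventually_sequentiallyI[of "nat \<lceil>K\<rceil>"]) linarith

lemma alternating_connectivity_2_ge:
  fixes \<epsilon> :: real
  assumes r: "r \<ge> 2" and \<epsilon>: "\<epsilon> > 0"
  shows "eventually (\<lambda>n. (1 - 1 / real r - \<epsilon>) * real n
           \<le> real (alternating_connectivity r 2 (complete_graph n))) sequentially"
proof -
  \<comment> \<open>Chosen so that the deviation over all \<open>r * (r - 1)\<close> types costs at
    most \<open>\<epsilon> / 2\<close> per vertex.\<close>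
  define \<delta> where "\<delta> = \<epsilon> / (2 * real r * real r)"
  have \<delta>: "\<delta> > 0" using \<epsilon> r by (simp add: \<delta>_def)
  have "eventually (\<lambda>n. \<exists>c. quasirandom_coloring r \<delta> n c) sequentially"
    by (rule ex_quasirandom_coloring) (use r \<delta> in auto)
  then show ?thesis
    \<comment> \<open>Then \<open>\<epsilon> / 2 * n\<close> is at least 3, which pays 2 for
      replacing \<open>n - 2\<close> by \<open>n\<close> and 1 for rounding down.\<close>
    using eventually_real_ge[of "6 / \<epsilon>"] eventually_ge_at_top[of 2]
  proof eventually_elim
    case (elim n)
    then obtain c where c: "quasirandom_coloring r \<delta> n c" by blast
    define x where "x = real r * (real r - 1) * ((1 / real r ^ 2 - \<delta>) * (real n - 2))"
    have 1: "real r * (real r - 1) * (1 / real r ^ 2) = 1 - 1 / real r"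
      using r by (simp add: field_simps power2_eq_square)
    have 2: "real r * (real r - 1) * \<delta> = \<epsilon> / 2 * (1 - 1 / real r)"
      using r by (simp add: \<delta>_def field_simps)
    have "x = (real r * (real r - 1) * (1 / real r ^ 2) - real r * (real r - 1) * \<delta>) * (real n - 2)"
      unfolding x_def by (simp only: right_diff_distrib mult.assoc[symmetric])
    also have "\<dots> = (1 - 1 / real r) * (real n - 2) - \<epsilon> / 2 * ((1 - 1 / real r) * (real n - 2))"
      unfolding 1 2 by (simp only: left_diff_distrib mult.assoc)
    also have "\<dots> \<ge> (1 - 1 / real r) * real n - 2 - \<epsilon> / 2 * real n"
    proof -
      have r1: "0 \<le> 1 - 1 / real r" "1 - 1 / real r \<le> 1" using r by auto
      have "(1 - 1 / real r) * (real n - 2) \<le> 1 * real n"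
        using r1 elim by (intro mult_mono) auto
      then have "\<epsilon> / 2 * ((1 - 1 / real r) * (real n - 2)) \<le> \<epsilon> / 2 * real n"
        using \<epsilon> by (intro mult_left_mono) auto
      moreover have "(1 - 1 / real r) * (real n - 2) \<ge> (1 - 1 / real r) * real n - 2"
        using r1 by (simp add: right_diff_distrib)
      ultimately show ?thesis by linarith
    qed
    finally have x: "x \<ge> (1 - 1 / real r) * real n - 2 - \<epsilon> / 2 * real n" .
    have \<epsilon>n: "6 \<le> \<epsilon> * real n" using elim \<epsilon> by (simp add: field_simps)
    show ?case
    proof (cases "x \<ge> 0")
      case True
      have "alternating_connected 2 (complete_graph n) c (nat \<lfloor>x\<rfloor>)"
        using alternating_connected_2_quasirandom[OF c, of "nat \<lfloor>x\<rfloor>"] r True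
        by (simp add: x_def[symmetric])
      then have "nat \<lfloor>x\<rfloor> \<le> alternating_connectivity r 2 (complete_graph n)"
        using c elim r by (intro alternating_connectivity_ge) (auto simp: quasirandom_coloring_def)
      moreover have "x - 1 \<le> real (nat \<lfloor>x\<rfloor>)" using True by linarith
      ultimately have "x - 1 \<le> real (alternating_connectivity r 2 (complete_graph n))" by linarith
      then show ?thesis using x \<epsilon>n unfolding left_diff_distrib[of _ \<epsilon>] by linarith
    next
      \<comment> \<open>Here the claimed lower bound is itself negative, so it holds
        trivially.\<close>
      case False
      then have "(1 - 1 / real r - \<epsilon>) * real n \<le> 0"
        using x \<epsilon>n unfolding left_diff_distrib[of _ \<epsilon>] by linarith
      then show ?thesis by (rule order_trans) simp
    qed
  qed
qed

lemma alternating_connectivity_ge_3_ge: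
  fixes \<epsilon> :: real
  assumes r: "r \<ge> 2" and l: "l \<ge> 3" and \<epsilon>: "\<epsilon> > 0"
  shows "eventually (\<lambda>n. (1 / (real l - 1) - \<epsilon>) * real n
           \<le> real (alternating_connectivity r l (complete_graph n))) sequentially"
proof -
  \<comment> \<open>The unit of error is \<open>E = \<eta> * n\<close>. The first bound makes
    \<open>16 * E\<close> at most \<open>\<epsilon> * n\<close>; the second keeps \<open>E\<close>
    small against \<open>n / (l - 1)\<close>, so that \<open>2 * s \<le> Q\<close> below.\<close>
  define \<eta> where "\<eta> = min (\<epsilon> / 16) (1 / (100 * real l))"
  have \<eta>: "\<eta> > 0" "\<eta> \<le> \<epsilon> / 16" "\<eta> \<le> 1 / (100 * real l)"
    using \<epsilon> l by (auto simp: \<eta>_def)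
  have "1 / (100 * real l) \<le> 1 / 300" using l by (intro divide_left_mono) auto
  then have \<eta>': "\<eta> \<le> 1 / 300" using \<eta> by linarith
  define \<delta> where "\<delta> = \<eta> / 8"
  have \<delta>: "\<delta> > 0" using \<eta> by (simp add: \<delta>_def)
  have "eventually (\<lambda>n. \<exists>c. quasirandom_coloring 2 \<delta> n c) sequentially"
    by (rule ex_quasirandom_coloring) (use \<delta> in auto)
  then show ?thesis
    using eventually_real_ge[of "100 / \<eta>\<^sup>2"] eventually_ge_at_top[of 2]
  proof eventually_elim
    case (elim n)
    then obtain c where c: "quasirandom_coloring 2 \<delta> n c" by blast
    define E where "E = \<eta> * real n"
    have \<eta>E: "100 \<le> \<eta> * E"
      using elim(2) \<eta>(1) by (simp add: E_def field_simps power2_eq_square)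
    have "E \<ge> 0" using \<eta> by (simp add: E_def)
    then have "\<eta> * E \<le> E" using \<eta> \<eta>' by (intro mult_left_le_one_le) auto
    then have E100: "100 \<le> E" using \<eta>E by linarith
    have En: "E \<le> real n / 300"
      using mult_right_mono[OF \<eta>', of "real n"] by (simp add: E_def)
    have E\<epsilon>: "16 * E \<le> \<epsilon> * real n"
      using mult_right_mono[OF \<eta>(2), of "real n"] by (simp add: E_def)
    have El: "100 * E \<le> real n / (real l - 1)"
    proof -
      have "E \<le> 1 / (100 * real l) * real n"
        using mult_right_mono[OF \<eta>(3), of "real n"] by (simp add: E_def)
      then have "100 * E \<le> real n / real l" by simp
      also have "\<dots> \<le> real n / (real l - 1)" using l by (intro divide_left_mono) auto
      finally show ?thesis .
    qed
    define s where "s = nat \<lceil>E\<rceil>"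
    have s: "E \<le> real s" "real s \<le> E + 1" "s \<ge> 1"
      using E100 by (auto simp: s_def) linarith+
    \<comment> \<open>If a color is missing between \<open>X\<close> and \<open>Y\<close>, then
      \<open>card X * card Y \<le> n + E / 2 * card X\<close>. As both sizes are at least
      \<open>E\<close>, this gives \<open>E * E \<le> 2 * n\<close>, whereas
      \<open>n \<ge> 100 / \<eta>^2\<close> makes \<open>E * E \<ge> 100 * n\<close>.\<close>
    have bc: "both_colors_between_sets s n c"
      unfolding both_colors_between_sets_def
    proof (intro allI impI, rule ccontr)
      fix X Y k
      assume XY: "X \<subseteq> {1..n}" "Y \<subseteq> {1..n}" "X \<inter> Y = {}" "s \<le> card X" "s \<le> card Y" "k \<in> {1, 2}"
        and no: "\<not> (\<exists>x\<in>X. \<exists>y\<in>Y. c {x, y} = k)"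
      have "real (card X) * real (card Y) \<le> real n + 4 * \<delta> * real n * real (card X)"
        using no by (intro no_edge_between_card_bound[OF c _ XY(1,2,3,6)]) (use \<delta> in auto)
      also have "4 * \<delta> * real n = E / 2" by (simp add: \<delta>_def E_def)
      finally have 1: "real (card X) * real (card Y) \<le> real n + E / 2 * real (card X)" .
      have EX: "E \<le> real (card X)" "E \<le> real (card Y)" using s XY by linarith+
      have "real (card X) * E \<le> real (card X) * real (card Y)"
        using EX by (intro mult_left_mono) auto
      then have "real (card X) * E \<le> 2 * real n" using 1 by (simp add: mult.commute)
      moreover have "E * E \<le> real (card X) * E" using EX E100 by (intro mult_right_mono) auto
      moreover have "E * E = (\<eta> * E) * real n" by (simp add: E_def)
      moreover have "100 * real n \<le> (\<eta> * E) * real n" using \<eta>E by (intro mult_right_mono) auto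
      ultimately show False using elim by linarith
    qed
    \<comment> \<open>\<open>2 * y\<close> is the guaranteed size of a joint type for two colors, so
      \<open>\<tau>\<close> is roughly \<open>n / 8\<close>.\<close>
    define y where "y = (1 / 8 - \<delta> / 2) * (real n - 2)"
    define \<tau> where "\<tau> = nat \<lfloor>y\<rfloor>"
    have "y = real n / 8 - E / 16 - 1 / 4 + \<delta>"
      by (simp add: y_def E_def \<delta>_def field_simps)
    then have y: "y \<ge> real n / 8 - E / 16 - 1 / 4" using \<delta> by linarith
    have y0: "y \<ge> 0" using y En E100 by linarith
    have \<tau>: "real \<tau> \<le> y" "y - 1 \<le> real \<tau>" unfolding \<tau>_def using y0 by linarith+
    have types: "2 * \<tau> \<le> card (joint_type n c u v i j)"
      if "u \<in> {1..n}" "v \<in> {1..n}" "u \<noteq> v" "i \<in> {1, 2}" "j \<in> {1, 2}" for u v i j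
    proof -
      have "i \<in> {1..2}" "j \<in> {1..2}" using that by auto
      then have "(1 / real 2 ^ 2 - \<delta>) * (real n - 2) \<le> real (card (joint_type n c u v i j))"
        using c that unfolding quasirandom_coloring_def by blast
      moreover have "(1 / real 2 ^ 2 - \<delta>) * (real n - 2) = 2 * y"
        by (simp add: y_def field_simps)
      ultimately show ?thesis using \<tau> by linarith
    qed
    have "edge_coloring 2 (complete_graph n) c"
      using c by (simp add: quasirandom_coloring_def)
    \<comment> \<open>A coloring need not use all its colors, so a 2-coloring is also an
      \<open>r\<close>-coloring.\<close>
    then have col: "edge_coloring r (complete_graph n) c"
      using r unfolding edge_coloring_def Pi_iff by (meson atLeastAtMost_iff le_trans)
    have "\<exists>t. alternating_connected l (complete_graph n) c t \<and> real n / (real l - 1) - 16 * E \<le> real t"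
    proof (cases "l = 3")
      case True
      have "2 * s \<le> \<tau>" using s \<tau> y En E100 by linarith
      then have "alternating_connected l (complete_graph n) c (4 * \<tau> - 4 * s)"
        using alternating_connected_3[OF bc s(3) types] True by simp
      moreover have "real n / (real l - 1) - 16 * E \<le> real (4 * \<tau> - 4 * s)"
      proof -
        have "real (4 * \<tau> - 4 * s) = 4 * real \<tau> - 4 * real s"
          using \<open>2 * s \<le> \<tau>\<close> by (simp add: of_nat_diff)
        moreover have "real n / (real l - 1) = real n / 2" using True by simp
        ultimately show ?thesis using s \<tau> y En E100 by linarith
      qed
      ultimately show ?thesis by blast
    next
      case False
      define m where "m = l - 2"
      have m: "m \<ge> 2" "l = m + 2" "real l - 1 = real (m + 1)" using l False by (auto simp: m_def)
      define Q where "Q = (n - 2) div (m + 1)"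
      have "n - 2 < (m + 1) + Q * (m + 1)"
        unfolding Q_def by (rule dividend_less_div_times) simp
      then have "real (n - 2) < real ((m + 1) + Q * (m + 1))" by (simp only: of_nat_less_iff)
      also have "\<dots> = (real Q + 1) * real (m + 1)" by (simp add: algebra_simps)
      finally have "real (n - 2) / real (m + 1) < real Q + 1"
        by (subst pos_divide_less_eq) auto
      moreover have "real (n - 2) / real (m + 1) = real n / real (m + 1) - 2 / real (m + 1)"
        using elim(3) by (simp add: of_nat_diff diff_divide_distrib)
      moreover have "2 / real (m + 1) \<le> 1" using m(1) by simp
      ultimately have Q1: "real Q \<ge> real n / (real l - 1) - 2" unfolding m(3) by linarith
      have Q2: "(m + 1) * Q \<le> n - 2" unfolding Q_def by (rule times_div_less_eq_dividend)
      \<comment> \<open>For \<open>l \<ge> 4\<close> there are at least three inner sets, so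
        \<open>Q\<close> is at most \<open>n / 3\<close>, below \<open>3 * \<tau>\<close>, which is
        about \<open>3 * n / 8\<close>. For \<open>l = 3\<close> sets of size about
        \<open>n / 2\<close> would be too large, hence the separate case.\<close>
      have "3 * Q \<le> (m + 1) * Q" using m by (intro mult_right_mono) auto
      then have "3 * real Q \<le> real n" using Q2 by linarith
      then have Q3: "Q \<le> 3 * \<tau>" using \<tau> y En E100 by linarith
      have sQ: "2 * s \<le> Q" using s Q1 El E100 by linarith
      have "alternating_connected (m + 2) (complete_graph n) c (Q - 2 * s)"
        by (rule alternating_connected_ge_3[OF bc s(3) types _ Q3 Q2]) (use m sQ in auto)
      moreover have "real n / (real l - 1) - 16 * E \<le> real (Q - 2 * s)"
        using sQ Q1 s E100 by (simp add: of_nat_diff)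
      ultimately show ?thesis using m by blast
    qed
    then obtain t where t: "alternating_connected l (complete_graph n) c t"
      "real n / (real l - 1) - 16 * E \<le> real t" by blast
    have "t \<le> alternating_connectivity r l (complete_graph n)"
      using t(1) col elim r by (intro alternating_connectivity_ge) auto
    moreover have "(1 / (real l - 1) - \<epsilon>) * real n = real n / (real l - 1) - \<epsilon> * real n"
      by (simp add: left_diff_distrib)
    ultimately show ?case using t(2) E\<epsilon> by linarith
  qed
qed

lemma asymp_equiv_linearI:
  fixes a :: "nat \<Rightarrow> real"
  assumes C: "C > 0" and upper: "eventually (\<lambda>n. a n \<le> C * real n) sequentially"
    and lower: "\<And>\<epsilon>. \<epsilon> > 0 \<Longrightarrow> eventually (\<lambda>n. (C - \<epsilon>) * real n \<le> a n) sequentially"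
  shows "a \<sim>[sequentially] (\<lambda>n. C * real n)"
proof (rule asymp_equivI', rule tendstoI)
  fix e :: real assume e: "e > 0"
  \<comment> \<open>An additive error \<open>C * e / 2\<close> per vertex is a relative error
    \<open>e / 2\<close>, strictly below \<open>e\<close>.\<close>
  have "eventually (\<lambda>n. (C - C * e / 2) * real n \<le> a n) sequentially"
    using C e by (intro lower) auto
  with upper show "eventually (\<lambda>n. dist (a n / (C * real n)) 1 < e) sequentially"
    using eventually_gt_at_top[of 0]
  proof eventually_elim
    case (elim n)
    have pos: "C * real n > 0" using C elim by simp
    have "a n / (C * real n) \<le> 1" using elim pos by (simp add: field_simps)
    moreover have "(1 - e / 2) * (C * real n) \<le> a n"
      using elim by (simp add: algebra_simps)
    then have "1 - e / 2 \<le> a n / (C * real n)" using pos by (simp add: pos_le_divide_eq)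
    ultimately show ?case using e by (simp add: dist_real_def)
  qed
qed

theorem theorem5p1:
  fixes r :: nat
  assumes "r \<ge> 2"
  shows "(\<lambda>n. real (alternating_connectivity r 2 (complete_graph n)))
           \<sim>[sequentially] (\<lambda>n. (1 - 1 / real r) * real n) \<and>
         (\<forall>l::nat. l \<ge> 3 \<longrightarrow>
           (\<lambda>n. real (alternating_connectivity r l (complete_graph n)))
             \<sim>[sequentially] (\<lambda>n. real n / (real l - 1)))"
proof (intro conjI allI impI)
  show "(\<lambda>n. real (alternating_connectivity r 2 (complete_graph n)))
           \<sim>[sequentially] (\<lambda>n. (1 - 1 / real r) * real n)"
  proof (rule asymp_equiv_linearI)
    show "eventually (\<lambda>n. real (alternating_connectivity r 2 (complete_graph n))
        \<le> (1 - 1 / real r) * real n) sequentially"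
      using eventually_ge_at_top[of 2]
    proof eventually_elim
      case (elim n)
      then obtain c where "edge_coloring r (complete_graph n) c"
        "alternating_connected 2 (complete_graph n) c (alternating_connectivity r 2 (complete_graph n))"
        using alternating_connectivity_attained[of n r 2] assms by auto
      then show ?case using elim assms by (intro alternating_connected_2_le) auto
    qed
  qed (use assms alternating_connectivity_2_ge in auto)
next
  fix l :: nat assume l: "l \<ge> 3"
  have "(\<lambda>n. real (alternating_connectivity r l (complete_graph n)))
           \<sim>[sequentially] (\<lambda>n. (1 / (real l - 1)) * real n)"
  proof (rule asymp_equiv_linearI)
    show "eventually (\<lambda>n. real (alternating_connectivity r l (complete_graph n))
        \<le> 1 / (real l - 1) * real n) sequentially"
      using eventually_ge_at_top[of 2]
    proof eventually_elim
      case (elim n)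
      let ?t = "alternating_connectivity r l (complete_graph n)"
      obtain c where "alternating_connected l (complete_graph n) c ?t"
        using alternating_connectivity_attained[of n r l] assms elim by auto
      then have "?t * (l - 1) \<le> n" by (rule alternating_connected_le[OF _ elim])
      then have "real ?t * real (l - 1) \<le> real n" by (simp flip: of_nat_mult)
      then show ?case using l by (simp add: of_nat_diff pos_le_divide_eq)
    qed
  qed (use l assms alternating_connectivity_ge_3_ge in auto)
  then show "(\<lambda>n. real (alternating_connectivity r l (complete_graph n)))
             \<sim>[sequentially] (\<lambda>n. real n / (real l - 1))"
    by simp
qed

end
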